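(* Let $n\ge 1$ and $p>1$. Let $X,Y$ be independent random vectors in $\mathbb{R}^n$, with densities with respect to Lebesgue measure, such that $X$, $Y$ and $X+Y$ have finite $p$-R\'enyi entropies. Then $$N_p(X+Y)^{\alpha}\ \geq\ N_p(X)^{\alpha}+N_p(Y)^{\alpha},$$ where $$\alpha=\left(1+\frac{1}{\log 2}\left(\frac{p+1}{p-1}\log\frac{p+1}{2p}+\frac{\log p}{p-1}\right)\right)^{-1}.$$
   Context: For a random vector $X$ in $\mathbb{R}^n$ with density $f$ with respect to Lebesgue measure and $p\in(0,1)\cup(1,\infty)$, the $p$-R\'enyi entropy is $h_p(X)=\frac{1}{1-p}\log\int_{\mathbb{R}^n}f(x)^p\,dx$, and the $p$-R\'enyi entropy power is $N_p(X)=e^{2h_p(X)/n}$. Here $\log$ is the natural logarithm. *)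

theory Defs
  imports "HOL-Probability.Probability"
begin

text \<open>Natural logarithm on \<open>[0, \<infinity>]\<close>, so that entropies take values in \<open>[-\<infinity>, \<infinity>]\<close> and
  finiteness of an entropy is a genuine condition.\<close>

definition ln_ennreal :: "ennreal \<Rightarrow> ereal" where
  "ln_ennreal x =
     (if x = 0 then -\<infinity> else if x = \<infinity> then \<infinity> else ereal (ln (enn2real x)))"

text \<open>The density of \<open>X\<close> is represented by the Radon--Nikodym derivative of its law with respect
  to Lebesgue measure, as in the library's \<open>entropy\<close>; \<open>renyi_entropy_eq\<close> shows that any
  density may be used instead. The value is meaningful only if \<open>X\<close> has a density.\<close>

definition renyi_entropy :: "real \<Rightarrow> 'w measure \<Rightarrow> ('w \<Rightarrow> real ^ 'n) \<Rightarrow> ereal" where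
  "renyi_entropy p M X =
     ereal (1 / (1 - p)) *
     ln_ennreal (\<integral>\<^sup>+ x. ennreal (enn2real (RN_deriv lborel (distr M lborel X) x) powr p) \<partial>lborel)"

text \<open>The entropy power is used only when the entropy is finite; \<open>real_of_ereal\<close> sends
  infinite values to \<open>0\<close>.\<close>

definition renyi_entropy_power :: "real \<Rightarrow> 'w measure \<Rightarrow> ('w \<Rightarrow> real ^ 'n) \<Rightarrow> real" where
  "renyi_entropy_power p M X =
     exp (2 * real_of_ereal (renyi_entropy p M X) / real CARD('n))"

definition renyi_epi_exponent :: "real \<Rightarrow> real" where
  "renyi_epi_exponent p =
     inverse (1 + 1 / ln 2 * ((p + 1) / (p - 1) * ln ((p + 1) / (2 * p)) + ln p / (p - 1)))"

lemma renyi_entropy_eq: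
  fixes X :: "'w \<Rightarrow> real ^ 'n"
  assumes "distributed M lborel X f"
  shows "renyi_entropy p M X =
    ereal (1 / (1 - p)) * ln_ennreal (\<integral>\<^sup>+ x. ennreal (enn2real (f x) powr p) \<partial>lborel)"
proof -
  have "AE x in lborel. f x = RN_deriv lborel (distr M lborel X) x"
    using assms by (intro sigma_finite_measure.RN_deriv_unique[OF sigma_finite_lborel]) (auto simp: distributed_def)
  then have "(\<integral>\<^sup>+ x. ennreal (enn2real (f x) powr p) \<partial>lborel) =
    (\<integral>\<^sup>+ x. ennreal (enn2real (RN_deriv lborel (distr M lborel X) x) powr p) \<partial>lborel)"
    by (intro nn_integral_cong_AE) (auto elim!: eventually_mono)
  then show ?thesis
    by (simp add: renyi_entropy_def)
qed

end

theory Submission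
  imports Defs
begin

text \<open>
  Let \<open>h\<close> be the density of \<open>X + Y\<close>. Writing \<open>\<integral> h\<^sup>p = \<integral>\<integral> f(x) g(y) h(x + y)\<^sup>p\<^sup>-\<^sup>1\<close>, the sharp trilinear form of
  Young's inequality, together with the interpolation of \<open>\<integral> f\<^sup>q\<close> between \<open>\<integral> f = 1\<close> and \<open>\<integral> f\<^sup>p\<close>,
  bounds the logarithm of \<open>N\<^sub>p(X + Y)\<close> from below by a convex combination with weights \<open>l\<close>, \<open>1 - l\<close> of
  the logarithms of \<open>N\<^sub>p(X)\<close> and \<open>N\<^sub>p(Y)\<close>, plus an explicit function of \<open>l\<close>. That function dominates
  the binary entropy of \<open>l\<close> divided by \<open>\<alpha>\<close>, with equality at \<open>l = 1/2\<close>; optimising over \<open>l\<close>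
  gives the claim.

  On the line, the sharp Young inequality follows from Barthe's transport argument: transporting the
  three densities to Gaussians, it reduces to the weighted arithmetic-geometric mean inequality for
  the Jacobian of an injective map of the plane and to a quadratic inequality for its norm. Fubini
  gives all dimensions.
\<close>

section \<open>The exponent\<close>

text \<open>For \<open>x < 1\<close>, subtract from the series of \<open>ln (1 - x)\<close> its
  multiple by \<open>x\<close>, aligned by an index shift. At \<open>x = 1\<close> the factor
  \<open>1 - x\<close> removes the logarithm and the series telescopes. This endpoint is included
  because binary entropy is the case \<open>c = 1\<close> of \<open>entropy_gap\<close>.\<close>

lemma one_minus_ln_sums:
  fixes x :: real
  assumes "0 \<le> x" "x \<le> 1"
  shows "(\<lambda>k. x ^ (k + 2) / ((k + 1) * (k + 2))) sums ((1 - x) * ln (1 - x) + x)"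
proof (cases "x = 1")
  case True
  have "(\<lambda>k. 1 / real (Suc k) - 1 / real (Suc (Suc k))) sums (1 / real (Suc 0) - 0)"
    by (rule telescope_sums'[OF LIMSEQ_Suc[OF lim_1_over_n]])
  moreover have "1 / real (Suc k) - 1 / real (Suc (Suc k)) = 1 / real ((k + 1) * (k + 2))" for k
    by (subst of_nat_mult) (simp add: divide_simps)
  ultimately have "(\<lambda>k. 1 / real ((k + 1) * (k + 2))) sums 1" by simp
  then show ?thesis using True by simp
next
  case False
  with assms have x: "\<bar>- x\<bar> < 1" by simp
  have "(\<lambda>n. - (x ^ n) / of_nat n) sums ln (1 - x)"
    using ln_series'[OF x] by simp
  then have l0: "(\<lambda>n. - (x ^ Suc n) / of_nat (Suc n)) sums ln (1 - x)"
    by (subst sums_Suc_iff) simp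
  then have l1: "(\<lambda>n. - (x ^ Suc (Suc n)) / of_nat (Suc (Suc n))) sums (ln (1 - x) + x)"
    by (subst sums_Suc_iff) simp
  from sums_diff[OF l1 sums_mult[OF l0, of x]]
  have "(\<lambda>n. - (x ^ Suc (Suc n)) / of_nat (Suc (Suc n)) - x * (- (x ^ Suc n) / of_nat (Suc n)))
    sums (ln (1 - x) + x - x * ln (1 - x))" .
  moreover have "- (x ^ Suc (Suc n)) / of_nat (Suc (Suc n)) - x * (- (x ^ Suc n) / of_nat (Suc n))
     = x ^ (n + 2) / ((n + 1) * (n + 2))" for n
    by (subst of_nat_mult, simp add: divide_simps) (simp add: algebra_simps)
  ultimately show ?thesis by (simp add: algebra_simps)
qed

text \<open>Let \<open>m\<close> be the first index with \<open>d m \<ge> 0\<close>. Replacing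
  \<open>c ^ k\<close> by \<open>c ^ m\<close> does not decrease any term: before \<open>m\<close>
  the coefficient is negative and \<open>c ^ k\<close> is at least \<open>c ^ m\<close>, from
  \<open>m\<close> on both comparisons are reversed. The new series sums to
  \<open>0 * c ^ m\<close>.\<close>

lemma sums_weighted_nonpos_of_sign_change:
  fixes d :: "nat \<Rightarrow> real"
  assumes "d sums 0" and s: "(\<lambda>k. d k * c ^ k) sums s"
    and c: "0 \<le> c" "c \<le> 1"
    and sign: "\<And>k. d k \<ge> 0 \<Longrightarrow> d (Suc k) \<ge> 0"
  shows "s \<le> 0"
proof (cases "\<exists>k. d k \<ge> 0")
  case False
  then have "d k * c ^ k \<le> 0" for k using c
    by (meson mult_nonpos_nonneg not_le_imp_less order_less_imp_le zero_le_power)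
  then show ?thesis by (rule sums_le[OF _ s sums_zero])
next
  case True
  define m where "m = (LEAST k. d k \<ge> 0)"
  have m: "d m \<ge> 0" unfolding m_def using True by (rule LeastI_ex)
  have low: "d k < 0" if "k < m" for k using not_less_Least[of k "\<lambda>k. d k \<ge> 0"] that m_def by force
  have high: "d k \<ge> 0" if "m \<le> k" for k using that
    by (induction k rule: dec_induct) (use m sign in auto)
  have "d k * c ^ k \<le> d k * c ^ m" for k
  proof (cases "k < m")
    case True
    then show ?thesis using low[of k] c by (intro mult_left_mono_neg power_decreasing) auto
  next
    case False
    then show ?thesis using high[of k] c by (intro mult_left_mono power_decreasing) auto
  qed
  then have "s \<le> 0 * c ^ m" by (rule sums_le[OF _ s sums_mult2[OF assms(1)]])
  then show ?thesis by simp
qed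

section \<open>Power defects and the monotonicity of their ratios\<close>

text \<open>For \<open>k \<ge> 2\<close>, division by \<open>k * (k - 1)\<close> gives the
  coefficient of \<open>c ^ k\<close> in the power series of \<open>entropy_gap c l\<close>.\<close>

definition power_defect :: "nat \<Rightarrow> real \<Rightarrow> real" where
  "power_defect k l = 1 - l ^ k - (1 - l) ^ k"

text \<open>Raising the exponent by one adds \<open>l * (1 - l)\<close> times a power sum. The
  common factor cancels when defects are compared, so that only partial sums of power sums
  remain.\<close>

lemma power_defect_eq_sum:
  "power_defect (m + 2) l = l * (1 - l) * (\<Sum>j\<le>m. l ^ j + (1 - l) ^ j)"
proof (induction m)
  case 0
  show ?case by (simp add: power_defect_def power2_eq_square algebra_simps)
next
  case (Suc m)
  have "power_defect (Suc m + 2) l = power_defect (m + 2) l + l * (1 - l) * (l ^ Suc m + (1 - l) ^ Suc m)"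
    by (simp add: power_defect_def algebra_simps)
  then show ?case using Suc by (simp add: algebra_simps)
qed

text \<open>Each increment of the exponent multiplies the power sum by at least
  \<open>1 / 2\<close>, since the difference is \<open>(l - 1/2) * (l ^ j - (1 - l) ^ j)\<close>, a
  product of factors of equal sign.\<close>

lemma power_sum_ratio_mono:
  fixes l :: real
  assumes "0 \<le> l" "l \<le> 1" "i \<le> j"
  shows "(l ^ i + (1 - l) ^ i) * (1 / 2) ^ j \<le> (l ^ j + (1 - l) ^ j) * (1 / 2) ^ i"
  using \<open>i \<le> j\<close>
proof (induction j rule: dec_induct)
  case (step j)
  have "(l ^ Suc j + (1 - l) ^ Suc j) - (l ^ j + (1 - l) ^ j) * (1 / 2) = (l - 1/2) * (l ^ j - (1 - l) ^ j)"
    by (simp add: algebra_simps)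
  also have "\<dots> \<ge> 0"
  proof (cases "l \<ge> 1/2")
    case True
    then show ?thesis using assms by (intro mult_nonneg_nonneg) (auto intro!: power_mono)
  next
    case False
    then show ?thesis using assms by (intro mult_nonpos_nonpos) (auto intro!: power_mono)
  qed
  finally have *: "(l ^ j + (1 - l) ^ j) * (1 / 2) \<le> l ^ Suc j + (1 - l) ^ Suc j" by simp
  have "(l ^ i + (1 - l) ^ i) * (1 / 2) ^ Suc j \<le> (l ^ j + (1 - l) ^ j) * (1 / 2) * (1 / 2) ^ i"
    using step.IH by simp
  also have "\<dots> \<le> (l ^ Suc j + (1 - l) ^ Suc j) * (1 / 2) ^ i"
    by (rule mult_right_mono[OF *]) simp
  finally show ?case .
qed simp

text \<open>In cross-multiplied form: up to a factor independent of \<open>m\<close>, the ratio of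
  the defects at \<open>l\<close> and at \<open>1 / 2\<close> is a quotient of partial sums of
  \<open>s\<close> and \<open>t\<close>. The ratio of the newly added terms is at least that of all
  earlier ones, so the quotient grows.\<close>

lemma power_defect_ratio_mono:
  assumes "0 \<le> l" "l \<le> 1"
  shows "power_defect (m + 2) l * power_defect (m + 3) (1 / 2)
    \<le> power_defect (m + 3) l * power_defect (m + 2) (1 / 2)"
proof -
  define s where "s j = l ^ j + (1 - l) ^ j" for j
  define t :: "nat \<Rightarrow> real" where "t j = (1 / 2) ^ j + (1 / 2) ^ j" for j
  have st: "s i * t j \<le> s j * t i" if "i \<le> j" for i j
    using power_sum_ratio_mono[OF assms that] unfolding s_def t_def by (simp add: algebra_simps)
  have "(\<Sum>j\<le>m. s j) * t (Suc m) \<le> s (Suc m) * (\<Sum>j\<le>m. t j)"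
    unfolding sum_distrib_left sum_distrib_right by (intro sum_mono st) simp
  then have "(\<Sum>j\<le>m. s j) * (\<Sum>j\<le>Suc m. t j) \<le> (\<Sum>j\<le>Suc m. s j) * (\<Sum>j\<le>m. t j)"
    by (simp add: algebra_simps)
  moreover have "0 \<le> l * (1 - l) * (1 / 4)" using assms by simp
  ultimately have le: "l * (1 - l) * (1 / 4) * ((\<Sum>j\<le>m. s j) * (\<Sum>j\<le>Suc m. t j)) \<le>
      l * (1 - l) * (1 / 4) * ((\<Sum>j\<le>Suc m. s j) * (\<Sum>j\<le>m. t j))"
    by (rule mult_left_mono)
  have e: "power_defect (k + 2) l = l * (1 - l) * (\<Sum>j\<le>k. s j)"
    and e2: "power_defect (k + 2) (1 / 2) = 1 / 4 * (\<Sum>j\<le>k. t j)" for k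
    unfolding power_defect_eq_sum s_def t_def by simp_all
  have m3: "m + 3 = Suc m + 2" by simp
  show ?thesis using le unfolding m3 e e2 by (simp only: ac_simps)
qed

section \<open>The entropy gap and its power series\<close>

text \<open>The superadditivity defect of \<open>x \<mapsto> (1 - x) * ln (1 - x)\<close> along
  \<open>c = l * c + (1 - l) * c\<close>. At \<open>c = 1\<close> it is the binary entropy of
  \<open>l\<close>; in the application \<open>c = (p - 1) / p\<close>.\<close>

definition entropy_gap :: "real \<Rightarrow> real \<Rightarrow> real" where
  "entropy_gap c l = (1 - c) * ln (1 - c) - (1 - l * c) * ln (1 - l * c)
     - (1 - (1 - l) * c) * ln (1 - (1 - l) * c)"

text \<open>The three linear terms from \<open>one_minus_ln_sums\<close> cancel because
  \<open>l * c + (1 - l) * c = c\<close>.\<close>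

lemma entropy_gap_sums:
  assumes "0 \<le> c" "c \<le> 1" "0 \<le> l" "l \<le> 1"
  shows "(\<lambda>k. power_defect (k + 2) l / ((k + 1) * (k + 2)) * c ^ (k + 2)) sums entropy_gap c l"
proof -
  have lc: "l * c \<le> 1" "(1 - l) * c \<le> 1" using assms by (auto intro: mult_le_one)
  note sums_diff[OF sums_diff[OF one_minus_ln_sums[of c] one_minus_ln_sums[of "l * c"]]
      one_minus_ln_sums[of "(1 - l) * c"]]
  then have "(\<lambda>k. c ^ (k + 2) / ((k + 1) * (k + 2)) - (l * c) ^ (k + 2) / ((k + 1) * (k + 2))
      - ((1 - l) * c) ^ (k + 2) / ((k + 1) * (k + 2)))
    sums ((1 - c) * ln (1 - c) + c - ((1 - l * c) * ln (1 - l * c) + l * c)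
      - ((1 - (1 - l) * c) * ln (1 - (1 - l) * c) + (1 - l) * c))"
    using assms lc by simp
  moreover have "c ^ (k + 2) / ((k + 1) * (k + 2)) - (l * c) ^ (k + 2) / ((k + 1) * (k + 2))
      - ((1 - l) * c) ^ (k + 2) / ((k + 1) * (k + 2)) =
      power_defect (k + 2) l / ((k + 1) * (k + 2)) * c ^ (k + 2)" for k
    unfolding power_mult_distrib power_defect_def by (simp add: divide_simps) (simp add: algebra_simps)
  ultimately show ?thesis by (simp add: entropy_gap_def algebra_simps)
qed

lemma entropy_gap_1: "entropy_gap 1 l = - l * ln l - (1 - l) * ln (1 - l)"
  by (simp add: entropy_gap_def)

lemma power_defect_half_pos: "power_defect (k + 2) (1 / 2) > 0"
  using power_one_over[of "2::real" "k+1"] one_less_power[of "2::real" "k+1"]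
  by (simp add: power_defect_def field_simps)

text \<open>The series in \<open>c\<close> of the difference of the two sides vanishes at \<open>c = 1\<close>, and its coefficients
  change sign once because the ratios \<open>power_defect k l / power_defect k (1 / 2)\<close> increase in \<open>k\<close>.\<close>

lemma entropy_gap_ratio_le:
  assumes "0 \<le> c" "c \<le> 1" "0 \<le> l" "l \<le> 1"
  shows "entropy_gap c l * ln 2 \<le> entropy_gap c (1 / 2) * entropy_gap 1 l"
proof -
  have h: "entropy_gap 1 (1 / 2) = ln 2" by (simp add: entropy_gap_1 ln_div)
  define e where "e k = power_defect (k + 2) l * ln 2 - power_defect (k + 2) (1 / 2) * entropy_gap 1 l" for k
  define d where "d k = e k / ((k + 1) * (k + 2))" for k
  have "(\<lambda>k. power_defect (k + 2) l / ((k + 1) * (k + 2)) * b ^ (k + 2) * ln 2 -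
      power_defect (k + 2) (1 / 2) / ((k + 1) * (k + 2)) * b ^ (k + 2) * entropy_gap 1 l)
    sums (entropy_gap b l * ln 2 - entropy_gap b (1 / 2) * entropy_gap 1 l)" if "0 \<le> b" "b \<le> 1" for b
    using that assms by (intro sums_diff sums_mult2 entropy_gap_sums) auto
  moreover have "power_defect (k + 2) l / ((k + 1) * (k + 2)) * b ^ (k + 2) * ln 2 -
      power_defect (k + 2) (1 / 2) / ((k + 1) * (k + 2)) * b ^ (k + 2) * entropy_gap 1 l = d k * b ^ k * b\<^sup>2"
    for k and b :: real
    unfolding d_def e_def by (simp add: divide_simps power2_eq_square) (simp add: algebra_simps)
  ultimately have ser: "(\<lambda>k. d k * b ^ k * b\<^sup>2) sums (entropy_gap b l * ln 2 - entropy_gap b (1 / 2) * entropy_gap 1 l)"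
    if "0 \<le> b" "b \<le> 1" for b using that by simp
  have sign: "e (Suc k) \<ge> 0" if "e k \<ge> 0" for k
  proof -
    \<comment> \<open>After multiplication by the positive defects at \<open>1 / 2\<close>, the
      terms containing \<open>entropy_gap 1 l\<close> agree on both sides, and the rest is the
      monotonicity of the ratios.\<close>
    have "0 \<le> e k * power_defect (k + 3) (1 / 2)"
      using that power_defect_half_pos[of "Suc k"] by (simp add: numeral_3_eq_3)
    also have "\<dots> \<le> e (Suc k) * power_defect (k + 2) (1 / 2)"
      using mult_right_mono[OF power_defect_ratio_mono[OF assms(3,4), of k], of "ln 2"]
      by (simp add: e_def algebra_simps numeral_3_eq_3)
    finally show ?thesis using power_defect_half_pos[of k] by (simp add: zero_le_mult_iff)
  qed
  have nn: "d k \<ge> 0 \<longleftrightarrow> e k \<ge> 0" for k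
  proof -
    have "0 < real ((k + 1) * (k + 2))" unfolding of_nat_0_less_iff by simp
    then show ?thesis unfolding d_def by (subst pos_le_divide_eq) simp_all
  qed
  show ?thesis
  proof (cases "c = 0")
    case True
    then show ?thesis by (simp add: entropy_gap_def)
  next
    case False
    \<comment> \<open>The common factor \<open>c\<^sup>2\<close> is divided out so that the weights
      are the plain powers \<open>c ^ k\<close>; at \<open>c = 1\<close> the sum vanishes since
      \<open>entropy_gap 1 (1 / 2) = ln 2\<close>.\<close>
    have "(\<lambda>k. d k * c ^ k) sums ((entropy_gap c l * ln 2 - entropy_gap c (1 / 2) * entropy_gap 1 l) / c\<^sup>2)"
      using sums_divide[OF ser[OF assms(1,2)], of "c\<^sup>2"] False by simp
    moreover have "d sums 0" using ser[of 1] h by simp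
    ultimately have "(entropy_gap c l * ln 2 - entropy_gap c (1 / 2) * entropy_gap 1 l) / c\<^sup>2 \<le> 0"
      using sums_weighted_nonpos_of_sign_change[of d c] assms(1,2) sign nn by meson
    then show ?thesis using False by (simp add: divide_le_0_iff)
  qed
qed

section \<open>Transport to the Gaussian\<close>

text \<open>The distribution function differs from an antiderivative of \<open>f\<close> by a
  constant, which gives the derivative; positivity of \<open>f\<close> gives strict growth, and the
  limits 0 and 1 with the intermediate value theorem give surjectivity onto the open unit
  interval.\<close>

lemma cdf_density_continuous:
  fixes f :: "real \<Rightarrow> real"
  assumes cont: "continuous_on UNIV f" and pos: "\<And>x. f x > 0"
    and one: "(\<integral>\<^sup>+x. ennreal (f x) \<partial>lborel) = 1"
  defines "F \<equiv> cdf (density lborel f)"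
  shows "(F has_real_derivative f x) (at x)" and "F x < F y \<longleftrightarrow> x < y" and "F x \<in> {0<..<1}"
    and "u \<in> {0<..<1} \<Longrightarrow> \<exists>x. F x = u"
proof -
  have [measurable]: "f \<in> borel_measurable borel"
    using cont by (rule borel_measurable_continuous_onI)
  interpret D: prob_space "density lborel f"
    by (rule prob_spaceI) (simp add: emeasure_density one)
  interpret D: real_distribution "density lborel f"
    by unfold_locales auto
  obtain G where G: "\<And>x. (G has_vector_derivative f x) (at x)"
    using einterval_antiderivative[of "-\<infinity>" "\<infinity>" f] cont continuous_on_eq_continuous_at[of UNIV f] by force
  have FG: "F y - F x = G y - G x" if "x \<le> y" for x y
  proof (cases "x = y")
    case False
    with that have "x < y" by simp
    have "emeasure (density lborel f) {x<..y} = (\<integral>\<^sup>+t. ennreal (f t) * indicator {x<..y} t \<partial>lborel)"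
      by (simp add: emeasure_density)
    also have "\<dots> = (\<integral>\<^sup>+t. ennreal (f t) * indicator {x..y} t \<partial>lborel)"
      by (intro nn_integral_cong_AE, rule eventually_mono[OF AE_lborel_singleton[of x]])
        (auto simp: indicator_def)
    also have "\<dots> = ennreal (G y - G x)"
    proof (rule nn_integral_FTC_Icc)
      show "(G has_real_derivative f t) (at t)" for t
        using G[of t] by (simp add: has_real_derivative_iff_has_vector_derivative)
      show "0 \<le> f t" for t by (rule less_imp_le[OF pos])
    qed (use that in auto)
    finally have em: "emeasure (density lborel f) {x<..y} = ennreal (G y - G x)" .
    have "G x \<le> G y"
    proof (rule DERIV_nonneg_imp_nondecreasing[OF that])
      show "\<exists>d. (G has_real_derivative d) (at t) \<and> 0 \<le> d" for t
        using G[of t] pos[of t] by (auto simp: has_real_derivative_iff_has_vector_derivative)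
    qed
    then have "measure (density lborel f) {x<..y} = G y - G x"
      using em by (intro measure_eq_emeasure_eq_ennreal) auto
    then show ?thesis using D.cdf_diff_eq[OF \<open>x < y\<close>] by (simp add: F_def)
  qed simp
  have FG': "F = (\<lambda>y. G y + (F 0 - G 0))"
  proof
    fix y show "F y = G y + (F 0 - G 0)"
      using FG[of 0 y] FG[of y 0] by (cases "0 \<le> y") auto
  qed
  show der: "(F has_real_derivative f x) (at x)" for x
  proof -
    have "(G has_real_derivative f x) (at x)"
      using G[of x] by (simp add: has_real_derivative_iff_has_vector_derivative)
    from DERIV_add[OF this DERIV_const[of "F 0 - G 0"]] show ?thesis
      by (subst FG') simp
  qed
  have mono: "F x < F y" if "x < y" for x y
    using DERIV_pos_imp_increasing[OF that] der pos by blast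
  then show "F x < F y \<longleftrightarrow> x < y" for x y
    by (metis not_less_iff_gr_or_eq)
  show "F x \<in> {0<..<1}"
    using mono[of "x - 1" x] mono[of x "x + 1"] D.cdf_nonneg[of "x - 1"] D.cdf_bounded_prob[of "x + 1"]
    by (simp add: F_def)
  assume u: "u \<in> {0<..<1}"
  have "\<forall>\<^sub>F x in at_bot. F x < u"
    using D.cdf_lim_at_bot u unfolding F_def by (auto dest: order_tendstoD)
  then obtain x where x: "F x < u" by (auto simp: eventually_at_bot_linorder)
  have "\<forall>\<^sub>F x in at_top. F x > u"
    using D.cdf_lim_at_top_prob u unfolding F_def by (auto dest: order_tendstoD)
  then obtain y where y: "F y > u" by (auto simp: eventually_at_top_linorder)
  have "x \<le> y" using x y mono[of y x] by (cases "x \<le> y") auto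
  moreover have "continuous_on {x..y} F"
    using der by (meson DERIV_isCont continuous_at_imp_continuous_on)
  ultimately show "\<exists>x. F x = u" using IVT'[of F x u y] x y by auto
qed

lemma nn_integral_std_normal_density: "(\<integral>\<^sup>+x. ennreal (std_normal_density x) \<partial>lborel) = 1"
  by (subst nn_integral_eq_integral) (auto intro: integrable_normal_density)

text \<open>The monotone rearrangement: \<open>T\<close> composes the distribution function of
  \<open>f\<close> with the inverse of the Gaussian one. Its derivative expresses \<open>f\<close>
  as \<open>T'\<close> times the Gaussian density at \<open>T\<close>.\<close>

lemma gaussian_transport:
  fixes f :: "real \<Rightarrow> real"
  assumes cont: "continuous_on UNIV f" and pos: "\<And>x. f x > 0"
    and one: "(\<integral>\<^sup>+x. ennreal (f x) \<partial>lborel) = 1"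
  obtains T where "\<And>x. (T has_real_derivative f x / std_normal_density (T x)) (at x)"
proof -
  have cn: "continuous_on UNIV std_normal_density"
    unfolding std_normal_density_def by (intro continuous_intros) auto
  have pn: "std_normal_density x > 0" for x by (rule normal_density_pos) simp
  note F = cdf_density_continuous[OF cont pos one]
  note N = cdf_density_continuous[OF cn pn nn_integral_std_normal_density]
  define F where "F = cdf (density lborel f)"
  define N where "N = cdf (density lborel std_normal_density)"
  have inj: "inj N"
    by (rule injI) (metis N(2) N_def less_irrefl linorder_neqE)
  define T where "T = inv N \<circ> F"
  have NT: "N (T x) = F x" for x
    using N(4)[OF F(3)[of x]] unfolding T_def o_def F_def N_def by (auto intro!: f_inv_into_f)
  have "(T has_real_derivative f x / std_normal_density (T x)) (at x)" for x
  proof -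
    have "(inv N has_derivative (*) (inverse (std_normal_density (T x)))) (at (N (T x)))"
    proof (rule has_derivative_inverse_strong[where f = N and g = "inv N", OF open_UNIV UNIV_I])
      show "continuous_on UNIV N"
        unfolding N_def using N(1) by (intro continuous_at_imp_continuous_on) (meson DERIV_isCont)
      show "inv N (N z) = z" for z by (rule inv_f_f[OF inj])
      show "(N has_derivative (*) (std_normal_density (T x))) (at (T x))"
        using N(1) by (simp add: N_def has_field_derivative_def)
      show "(*) (std_normal_density (T x)) \<circ> (*) (inverse (std_normal_density (T x))) = id"
        using pn[of "T x"] by (auto simp: fun_eq_iff)
    qed
    then have "(inv N has_real_derivative inverse (std_normal_density (T x))) (at (N (T x)))"
      by (simp add: has_field_derivative_def)
    then have "(inv N has_real_derivative inverse (std_normal_density (T x))) (at (F x))"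
      by (simp add: NT)
    moreover have "(F has_real_derivative f x) (at x)" using F(1) by (simp add: F_def)
    ultimately have "((\<lambda>x. inv N (F x)) has_real_derivative inverse (std_normal_density (T x)) * f x) (at x)"
      by (rule DERIV_chain2)
    then show ?thesis
      by (simp add: T_def o_def divide_inverse mult.commute)
  qed
  then show thesis by (rule that)
qed

section \<open>Integration over the plane\<close>

text \<open>Links iterated integrals with the type \<open>real ^ 2\<close>, on which determinants
  and the change of variables live. The image of the product measure agrees with
  \<open>lborel\<close> on boxes, which determines it.\<close>

lemma nn_integral_lborel_vec2:
  fixes f :: "real ^ 2 \<Rightarrow> ennreal"
  assumes [measurable]: "f \<in> borel_measurable borel"
  shows "(\<integral>\<^sup>+v. f v \<partial>lborel) = (\<integral>\<^sup>+x. \<integral>\<^sup>+y. f (vector [x, y]) \<partial>lborel \<partial>lborel)"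
proof -
  define m where "m = (\<lambda>(x, y). vector [x, y] :: real ^ 2)"
  have m_eq: "m = (\<lambda>z. fst z *\<^sub>R axis 1 1 + snd z *\<^sub>R axis 2 1)"
    by (auto simp: m_def fun_eq_iff vec_eq_iff forall_2 axis_def)
  have m[measurable]: "m \<in> borel_measurable borel"
    unfolding m_eq by (intro borel_measurable_continuous_onI continuous_intros)
  have "(lborel :: (real ^ 2) measure) = distr lborel borel m"
  proof (rule lborel_eqI)
    fix l u :: "real ^ 2" assume lu: "\<And>b. b \<in> Basis \<Longrightarrow> l \<bullet> b \<le> u \<bullet> b"
    have "axis 1 1 \<in> (Basis :: (real ^ 2) set)" "axis 2 1 \<in> (Basis :: (real ^ 2) set)"
      by (auto simp: Basis_vec_def)
    from lu[OF this(1)] lu[OF this(2)] have le: "l $ 1 \<le> u $ 1" "l $ 2 \<le> u $ 2" by (auto simp: inner_axis)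
    have "m -` box l u = box (l $ 1) (u $ 1) \<times> box (l $ 2) (u $ 2)"
      by (auto simp: m_def mem_box_cart forall_2 mem_box)
    then have "emeasure (distr lborel borel m) (box l u) = emeasure (lborel \<Otimes>\<^sub>M lborel) (box (l $ 1) (u $ 1) \<times> box (l $ 2) (u $ 2))"
      by (simp add: emeasure_distr lborel_prod)
    also have "\<dots> = ennreal (u $ 1 - l $ 1) * ennreal (u $ 2 - l $ 2)"
      using le by (simp add: lborel.emeasure_pair_measure_Times emeasure_lborel_box_eq)
    also have "\<dots> = ennreal (\<Prod>b\<in>Basis. (u - l) \<bullet> b)"
    proof -
      have B: "(Basis :: (real ^ 2) set) = {axis 1 1, axis 2 1}"
        by (auto simp: Basis_vec_def) (metis exhaust_2)
      have "axis 1 1 \<noteq> (axis 2 1 :: real ^ 2)" by (simp add: axis_eq_axis)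
      then show ?thesis using le unfolding B by (simp add: inner_axis ennreal_mult)
    qed
    finally show "emeasure (distr lborel borel m) (box l u) = ennreal (\<Prod>b\<in>Basis. (u - l) \<bullet> b)" .
  qed simp
  then have "(\<integral>\<^sup>+v. f v \<partial>lborel) = (\<integral>\<^sup>+v. f v \<partial>distr lborel borel m)" by simp
  also have "\<dots> = (\<integral>\<^sup>+z. f (m z) \<partial>lborel)" by (rule nn_integral_distr) auto
  also have "\<dots> = (\<integral>\<^sup>+z. f (m z) \<partial>(lborel \<Otimes>\<^sub>M lborel))" by (simp add: lborel_prod)
  also have "\<dots> = (\<integral>\<^sup>+x. \<integral>\<^sup>+y. f (m (x, y)) \<partial>lborel \<partial>lborel)"
    by (subst lborel.nn_integral_fst[symmetric]) (auto simp: lborel_prod)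
  finally show ?thesis by (simp add: m_def)
qed

text \<open>The change of variables is an equality with the integral of \<open>F\<close> over
  \<open>range g\<close>; enlarging the range to the whole space gives the inequality.\<close>

lemma nn_integral_change_of_variables_le:
  fixes g :: "real ^ 'n::{finite,wellorder} \<Rightarrow> real ^ 'n::_" and F :: "real ^ 'n::_ \<Rightarrow> real"
  assumes der: "\<And>x. (g has_derivative g' x) (at x)" and inj: "inj g"
    and F[measurable]: "F \<in> borel_measurable borel" and nn: "\<And>x. F x \<ge> 0"
    and fin: "(\<integral>\<^sup>+x. ennreal (F x) \<partial>lborel) < \<infinity>"
  shows "(\<integral>\<^sup>+x. ennreal (\<bar>det (matrix (g' x))\<bar> * F (g x)) \<partial>lborel) \<le> (\<integral>\<^sup>+x. ennreal (F x) \<partial>lborel)"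
proof -
  have int: "integrable lborel F" using fin nn by (intro integrableI_bounded) auto
  have Fabs: "F absolutely_integrable_on UNIV"
    using int by (auto simp: set_integrable_def integrable_completion)
  have ms: "range g \<in> sets lebesgue"
    using der by (intro differentiable_image_in_sets_lebesgue)
      (auto simp: differentiable_on_def differentiable_def)
  have comp: "F absolutely_integrable_on range g"
    using Fabs ms by (rule set_integrable_subset) auto
  define b where "b = integral (range g) F"
  \<comment> \<open>The change of variables theorem concerns vector-valued functions, so
    \<open>F\<close> is read as a function into \<open>real ^ 1\<close>.\<close>
  have "(\<lambda>x. \<bar>det (matrix (g' x))\<bar> *\<^sub>R (vec (F (g x)) :: real ^ 1)) absolutely_integrable_on UNIV \<and>
      integral UNIV (\<lambda>x. \<bar>det (matrix (g' x))\<bar> *\<^sub>R (vec (F (g x)) :: real ^ 1)) = vec b \<longleftrightarrow>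
      (\<lambda>x. vec (F x) :: real ^ 1) absolutely_integrable_on range g \<and>
      integral (range g) (\<lambda>x. vec (F x) :: real ^ 1) = vec b"
    using der inj by (intro has_absolute_integral_change_of_variables) (auto intro: has_derivative_at_withinI)
  then have "(\<lambda>x. \<bar>det (matrix (g' x))\<bar> * F (g x)) absolutely_integrable_on UNIV \<and>
      integral UNIV (\<lambda>x. \<bar>det (matrix (g' x))\<bar> * F (g x)) = b"
    using comp by (simp add: absolutely_integrable_on_1_iff integral_on_1_eq b_def)
  then have "((\<lambda>x. \<bar>det (matrix (g' x))\<bar> * F (g x)) has_integral b) UNIV"
    using set_lebesgue_integral_eq_integral(1) by (metis integrable_integral)
  then have "(\<integral>\<^sup>+x. ennreal (\<bar>det (matrix (g' x))\<bar> * F (g x)) \<partial>lborel) = ennreal b"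
    using nn_integral_has_integral_lebesgue[of UNIV "\<lambda>x. \<bar>det (matrix (g' x))\<bar> * F (g x)" b] nn by simp
  also have "b \<le> integral UNIV F"
    unfolding b_def using comp Fabs nn
    by (intro integral_subset_le) (auto dest: set_lebesgue_integral_eq_integral(1))
  then have "ennreal b \<le> ennreal (integral UNIV F)" by (rule ennreal_leI)
  also have "ennreal (integral UNIV F) = (\<integral>\<^sup>+x. ennreal (F x) \<partial>lborel)"
    using nn_integral_has_integral_lborel[OF F nn] has_integral_integral_lborel[OF int]
    by (metis integral_unique)
  finally show ?thesis .
qed

section \<open>The sharp Young inequality\<close>

text \<open>For \<open>a + b + c = 2\<close> this is the sharp constant in the trilinear Young
  inequality on the line with Lebesgue exponents \<open>1 / a\<close>, \<open>1 / b\<close>,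
  \<open>1 / c\<close>: then its square is the product of
  \<open>(1 - t) powr (1 - t) / t powr t\<close> over \<open>t = a, b, c\<close>. The form chosen
  here is the one in which the Gaussian parameters \<open>(1 - a) / (b * c)\<close> etc. are
  visible.\<close>

definition young_const :: "real \<Rightarrow> real \<Rightarrow> real \<Rightarrow> real" where
  "young_const a b c = exp (((1 - a) * ln ((1 - a) / (b * c)) + (1 - b) * ln ((1 - b) / (a * c))
     + (1 - c) * ln ((1 - c) / (a * b))) / 2)"

lemma young_const_pos: "young_const a b c > 0"
  by (simp add: young_const_def)

text \<open>Convexity of the exponential: each variable lies above the tangent to \<open>exp\<close>
  at the weighted mean \<open>L\<close> of the logarithms, and the weighted tangents add up to
  \<open>exp L\<close>.\<close>

lemma weighted_am_gm_3:
  fixes x y z :: real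
  assumes "0 < x" "0 < y" "0 < z" "0 \<le> u" "0 \<le> v" "0 \<le> w" "u + v + w = 1"
  shows "exp (u * ln x + v * ln y + w * ln z) \<le> u * x + v * y + w * z"
proof -
  define L where "L = u * ln x + v * ln y + w * ln z"
  have tangent: "exp L * (1 + (ln t - L)) \<le> t" if "0 < t" for t
  proof -
    have "exp L * (1 + (ln t - L)) \<le> exp L * exp (ln t - L)"
      by (intro mult_left_mono exp_ge_add_one_self) simp
    also have "\<dots> = t" using that by (simp flip: exp_add)
    finally show ?thesis .
  qed
  have "u * (exp L * (1 + (ln x - L))) + v * (exp L * (1 + (ln y - L))) + w * (exp L * (1 + (ln z - L)))
    \<le> u * x + v * y + w * z"
    using assms by (intro add_mono mult_left_mono tangent) auto
  also have "u * (exp L * (1 + (ln x - L))) + v * (exp L * (1 + (ln y - L))) + w * (exp L * (1 + (ln z - L)))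
    = exp L * ((u + v + w) * (1 - L) + L)"
    by (simp add: L_def algebra_simps)
  also have "\<dots> = exp L" using assms by simp
  finally show ?thesis by (simp add: L_def)
qed

text \<open>Each density is the derivative of its transport map times a Gaussian factor. The product
  of the derivatives is at most \<open>K\<close> times the Jacobian of \<open>\<Theta>\<close>, and
  the product of the Gaussian factors is at most the planar Gaussian density at
  \<open>\<Theta>\<close>. The change of variables then bounds the integral by
  \<open>K\<close>.\<close>

lemma brascamp_lieb_line_continuous:
  fixes f g h :: "real \<Rightarrow> real"
  assumes abc: "0 < a" "a < 1" "0 < b" "b < 1" "0 < c" "c < 1" "a + b + c = 2"
    and f: "continuous_on UNIV f" "\<And>x. f x > 0" "(\<integral>\<^sup>+x. ennreal (f x) \<partial>lborel) = 1"
    and g: "continuous_on UNIV g" "\<And>x. g x > 0" "(\<integral>\<^sup>+x. ennreal (g x) \<partial>lborel) = 1"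
    and h: "continuous_on UNIV h" "\<And>x. h x > 0" "(\<integral>\<^sup>+x. ennreal (h x) \<partial>lborel) = 1"
  shows "(\<integral>\<^sup>+x. \<integral>\<^sup>+y. ennreal (f x powr a * g y powr b * h (x + y) powr c) \<partial>lborel \<partial>lborel)
    \<le> ennreal (young_const a b c)"
proof -
  define K where "K = young_const a b c"
  \<comment> \<open>Chosen so that the weights \<open>1 - a\<close>, \<open>1 - b\<close>,
    \<open>1 - c\<close> of the arithmetic-geometric mean inequality match the coefficients of the
    Jacobian, and so that
    \<open>K = A powr (1 - a) * B powr (1 - b) * C powr (1 - c)\<close>.\<close>
  define A where "A = sqrt ((1 - a) / (b * c))"
  define B where "B = sqrt ((1 - b) / (a * c))"
  define C where "C = sqrt ((1 - c) / (a * b))"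
  have ABC: "A > 0" "B > 0" "C > 0" and sq: "b * c * A\<^sup>2 = 1 - a" "a * c * B\<^sup>2 = 1 - b" "a * b * C\<^sup>2 = 1 - c"
    using abc by (auto simp: A_def B_def C_def)
  have K0: "K > 0" by (simp add: K_def young_const_def)
  have lnK: "ln K = (1 - a) * ln A + (1 - b) * ln B + (1 - c) * ln C"
  proof -
    have "ln A = ln ((1 - a) / (b * c)) / 2" "ln B = ln ((1 - b) / (a * c)) / 2" "ln C = ln ((1 - c) / (a * b)) / 2"
      unfolding A_def B_def C_def using abc by (simp_all add: ln_sqrt)
    note ln_ABC = this
    show ?thesis unfolding K_def young_const_def ln_exp ln_ABC by (simp add: add_divide_distrib)
  qed
  \<comment> \<open>The lower diagonal entry of the decomposition of the identity; multiplied by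
    \<open>a\<close> it reads \<open>(1 - c) + (1 - b) = a\<close>.\<close>
  have one: "b * C\<^sup>2 + c * B\<^sup>2 = 1"
  proof -
    have "a * (b * C\<^sup>2 + c * B\<^sup>2) = a * 1" using sq abc by (simp add: algebra_simps)
    then show ?thesis using abc by (metis less_irrefl mult_left_cancel)
  qed
  define N where "N = std_normal_density"
  have N0: "N x > 0" for x unfolding N_def by (rule normal_density_pos) simp
  obtain T1 where T1: "\<And>x. (T1 has_real_derivative f x / N (T1 x)) (at x)"
    using gaussian_transport[OF f] unfolding N_def by blast
  obtain T2 where T2: "\<And>x. (T2 has_real_derivative g x / N (T2 x)) (at x)"
    using gaussian_transport[OF g] unfolding N_def by blast
  obtain T3 where T3: "\<And>x. (T3 has_real_derivative h x / N (T3 x)) (at x)"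
    using gaussian_transport[OF h] unfolding N_def by blast
  define p where "p x = f x / N (T1 x)" for x
  define q where "q x = g x / N (T2 x)" for x
  define r where "r x = h x / N (T3 x)" for x
  note T = T1[folded p_def] T2[folded q_def] T3[folded r_def]
  have pqr: "p x > 0" "q x > 0" "r x > 0" for x
    unfolding p_def q_def r_def using f g h N0 by simp_all
  have mono: "S x < S y \<longleftrightarrow> x < y" if "\<And>x. (S has_real_derivative s x) (at x)" "\<And>x. s x > 0" for S s x y
  proof -
    have "S x < S y" if "x < y" for x y
      using DERIV_pos_imp_increasing[OF that, of S] \<open>\<And>x. (S has_real_derivative s x) (at x)\<close> \<open>\<And>x. s x > 0\<close> by blast
    then show ?thesis by (metis not_less_iff_gr_or_eq)
  qed
  note mono = mono[OF T(1) pqr(1)] mono[OF T(2) pqr(2)] mono[OF T(3) pqr(3)]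
  \<comment> \<open>\<open>\<Theta> = a T1 v1 + b T2 v2 + c T3 v3\<close> for \<open>v1 = (1, 0)\<close>, \<open>v2 = (- c A B, C)\<close>, \<open>v3 = (b A C, B)\<close>.
    These are unit vectors decomposing the identity as \<open>a v1 v1\<^sup>T + b v2 v2\<^sup>T + c v3 v3\<^sup>T\<close>, and their
    pairwise determinants are \<open>C\<close>, \<open>B\<close>, \<open>A\<close>.\<close>
  define \<theta>1 where "\<theta>1 v = a * T1 (v $ 1) - b * c * A * B * T2 (v $ 2) + b * c * A * C * T3 (v $ 1 + v $ 2)" for v :: "real ^ 2"
  define \<theta>2 where "\<theta>2 v = b * C * T2 (v $ 2) + c * B * T3 (v $ 1 + v $ 2)" for v :: "real ^ 2"
  define \<Theta> where "\<Theta> v = \<theta>1 v *\<^sub>R axis 1 1 + \<theta>2 v *\<^sub>R (axis 2 1 :: real ^ 2)" for v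
  have comp: "\<Theta> v $ 1 = \<theta>1 v" "\<Theta> v $ 2 = \<theta>2 v" for v
    by (auto simp: \<Theta>_def axis_def)
  define \<Theta>' where "\<Theta>' v = (\<lambda>w :: real ^ 2.
      (a * (p (v $ 1) * w $ 1) - b * c * A * B * (q (v $ 2) * w $ 2) + b * c * A * C * (r (v $ 1 + v $ 2) * (w $ 1 + w $ 2))) *\<^sub>R axis 1 1
      + (b * C * (q (v $ 2) * w $ 2) + c * B * (r (v $ 1 + v $ 2) * (w $ 1 + w $ 2))) *\<^sub>R (axis 2 1 :: real ^ 2))" for v :: "real ^ 2"
  have chain: "((\<lambda>v. S (k v)) has_derivative (\<lambda>w. s (k v) * k' w)) (at v)"
    if "\<And>x. (S has_real_derivative s x) (at x)" "(k has_derivative k') (at v)" for S s k k' and v :: "real ^ 2"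
    using has_derivative_compose[OF that(2), of S "(*) (s (k v))"] that(1)[of "k v"]
    by (simp add: has_field_derivative_def)
  have der: "(\<Theta> has_derivative \<Theta>' v) (at v)" for v
    unfolding \<Theta>_def \<theta>1_def \<theta>2_def \<Theta>'_def
    by (intro has_derivative_add has_derivative_diff has_derivative_scaleR_left has_derivative_mult_right
      chain T bounded_linear_imp_has_derivative bounded_linear_vec_nth)
  have det: "det (matrix (\<Theta>' v)) = a * b * C * (p x * q y) + a * c * B * (p x * r z) + b * c * A * (q y * r z)"
    if "x = v $ 1" "y = v $ 2" "z = v $ 1 + v $ 2" for v x y z
  proof -
    have "det (matrix (\<Theta>' v)) = (a * p x + b * c * A * C * r z) * (b * C * q y + c * B * r z)
      - (b * c * A * C * r z - b * c * A * B * q y) * (c * B * r z)"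
      unfolding det_2 matrix_def \<Theta>'_def that by (simp add: axis_def)
    also have "\<dots> = a * b * C * (p x * q y) + a * c * B * (p x * r z) + b * c * A * (q y * r z) * (b * C\<^sup>2 + c * B\<^sup>2)"
      by (simp add: algebra_simps power2_eq_square)
    finally show ?thesis by (simp add: one)
  qed
  \<comment> \<open>The means are taken of \<open>P * Q / C\<close>, \<open>P * R / B\<close>,
    \<open>Q * R / A\<close> with weights \<open>1 - c\<close>, \<open>1 - b\<close>,
    \<open>1 - a\<close>, which add up to 1. The exponent of \<open>P\<close> becomes
    \<open>(1 - c) + (1 - b) = a\<close>, and similarly for \<open>Q\<close> and
    \<open>R\<close>.\<close>
  have det_ge: "P powr a * Q powr b * R powr c \<le> K * (a * b * C * (P * Q) + a * c * B * (P * R) + b * c * A * (Q * R))"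
    if "P > 0" "Q > 0" "R > 0" for P Q R
  proof -
    have "exp ((1 - c) * ln (P * Q / C) + (1 - b) * ln (P * R / B) + (1 - a) * ln (Q * R / A))
      \<le> (1 - c) * (P * Q / C) + (1 - b) * (P * R / B) + (1 - a) * (Q * R / A)"
      using that abc ABC by (intro weighted_am_gm_3) auto
    also have "\<dots> = a * b * C * (P * Q) + a * c * B * (P * R) + b * c * A * (Q * R)"
      unfolding sq[symmetric] using ABC by (simp add: power2_eq_square)
    also have "(1 - c) * ln (P * Q / C) + (1 - b) * ln (P * R / B) + (1 - a) * ln (Q * R / A)
        = (2 - b - c) * ln P + (2 - a - c) * ln Q + (2 - a - b) * ln R - ln K"
      using that ABC by (simp add: ln_mult ln_div lnK algebra_simps)
    also have "\<dots> = a * ln P + b * ln Q + c * ln R - ln K"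
    proof -
      have "2 - b - c = a" "2 - a - c = b" "2 - a - b = c" using abc by linarith+
      note e = this
      show ?thesis unfolding e ..
    qed
    also have "exp \<dots> = P powr a * Q powr b * R powr c / K"
      using that K0 by (simp add: exp_add exp_diff powr_def)
    finally show ?thesis using K0 by (simp add: pos_divide_le_eq mult.commute)
  qed
  \<comment> \<open>If \<open>\<delta>3 > 0\<close>, the second coordinate forces
    \<open>\<delta>2 < 0\<close>, and then the first forces \<open>\<delta>1 < 0\<close>. As the
    transport maps increase, both coordinates would drop while their sum rises. The case
    \<open>\<delta>3 < 0\<close> is symmetric.\<close>
  have inj: "inj \<Theta>"
  proof (rule injI)
    fix v w assume "\<Theta> v = \<Theta> w"
    then have eq: "\<theta>1 v = \<theta>1 w" "\<theta>2 v = \<theta>2 w" using comp by metis+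
    define \<delta>1 where "\<delta>1 = T1 (v $ 1) - T1 (w $ 1)"
    define \<delta>2 where "\<delta>2 = T2 (v $ 2) - T2 (w $ 2)"
    define \<delta>3 where "\<delta>3 = T3 (v $ 1 + v $ 2) - T3 (w $ 1 + w $ 2)"
    have e: "a * \<delta>1 + b * c * A * (C * \<delta>3 - B * \<delta>2) = 0" "b * C * \<delta>2 + c * B * \<delta>3 = 0"
      using eq by (auto simp: \<theta>1_def \<theta>2_def \<delta>1_def \<delta>2_def \<delta>3_def algebra_simps)
    have s: "\<delta>1 < 0 \<longleftrightarrow> v $ 1 < w $ 1" "0 < \<delta>1 \<longleftrightarrow> w $ 1 < v $ 1" "\<delta>2 < 0 \<longleftrightarrow> v $ 2 < w $ 2" "0 < \<delta>2 \<longleftrightarrow> w $ 2 < v $ 2"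
      "\<delta>3 < 0 \<longleftrightarrow> v $ 1 + v $ 2 < w $ 1 + w $ 2" "0 < \<delta>3 \<longleftrightarrow> w $ 1 + w $ 2 < v $ 1 + v $ 2"
      unfolding \<delta>1_def \<delta>2_def \<delta>3_def using mono by simp_all
    have pos: "b * C > 0" "c * B > 0" "b * c * A > 0" using abc ABC by simp_all
    consider "\<delta>3 > 0" | "\<delta>3 < 0" | "\<delta>3 = 0" by linarith
    then show "v = w"
    proof cases
      case 1
      then have "c * B * \<delta>3 > 0" using pos by simp
      then have "b * C * \<delta>2 < 0" using e by linarith
      then have d2: "\<delta>2 < 0" using abc ABC by (auto simp: mult_less_0_iff zero_less_mult_iff)
      then have "B * \<delta>2 < 0" "C * \<delta>3 > 0" using 1 ABC by (auto simp: mult_less_0_iff)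
      then have "b * c * A * (C * \<delta>3 - B * \<delta>2) > 0"
        using mult_pos_pos[OF pos(3), of "C * \<delta>3 - B * \<delta>2"] by simp
      then have "a * \<delta>1 < 0" using e by linarith
      then have "\<delta>1 < 0" using abc by (auto simp: mult_less_0_iff)
      then show ?thesis using s 1 d2 by linarith
    next
      case 2
      then have "c * B * \<delta>3 < 0" using abc ABC by (auto simp: mult_less_0_iff zero_less_mult_iff)
      then have "b * C * \<delta>2 > 0" using e by linarith
      then have d2: "\<delta>2 > 0" using abc ABC by (auto simp: mult_less_0_iff zero_less_mult_iff)
      then have "B * \<delta>2 > 0" "C * \<delta>3 < 0" using 2 ABC by (auto simp: mult_less_0_iff)
      then have "b * c * A * (C * \<delta>3 - B * \<delta>2) < 0"
        using mult_pos_neg[OF pos(3), of "C * \<delta>3 - B * \<delta>2"] by simp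
      then have "a * \<delta>1 > 0" using e by linarith
      then have "\<delta>1 > 0" using abc by (auto simp: zero_less_mult_iff)
      then show ?thesis using s 2 d2 by linarith
    next
      case 3
      then have "\<delta>2 = 0" using e abc ABC by simp
      moreover from this have "\<delta>1 = 0" using e 3 abc by simp
      ultimately show ?thesis using s by (simp add: vec_eq_iff forall_2)
    qed
  qed
  \<comment> \<open>\<open>K\<close> times the standard Gaussian density of the plane, hence of
    total mass \<open>K\<close>.\<close>
  define G where "G v = K * (N (v $ 1) * N (v $ 2))" for v :: "real ^ 2"
  have Nm[measurable]: "N \<in> borel_measurable borel" by (simp add: N_def)
  have Gm[measurable]: "G \<in> borel_measurable borel"
    unfolding G_def by measurable
  have iN: "(\<integral>\<^sup>+x. ennreal (N x) \<partial>lborel) = 1" unfolding N_def by (rule nn_integral_std_normal_density)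
  have "(\<integral>\<^sup>+v. ennreal (G v) \<partial>lborel) = (\<integral>\<^sup>+x. \<integral>\<^sup>+y. (ennreal K * ennreal (N x)) * ennreal (N y) \<partial>lborel \<partial>lborel)"
    using N0 K0 by (subst nn_integral_lborel_vec2) (auto simp: G_def ennreal_mult less_imp_le mult.assoc)
  also have "\<dots> = ennreal K"
    by (simp add: nn_integral_cmult iN)
  finally have iG: "(\<integral>\<^sup>+v. ennreal (G v) \<partial>lborel) = ennreal K" .
  have bound: "f x powr a * g y powr b * h z powr c \<le> \<bar>det (matrix (\<Theta>' v))\<bar> * G (\<Theta> v)"
    if xyz: "x = v $ 1" "y = v $ 2" "z = v $ 1 + v $ 2" for v x y z
  proof -
    define D where "D = a * b * C * (p x * q y) + a * c * B * (p x * r z) + b * c * A * (q y * r z)"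
    have D: "det (matrix (\<Theta>' v)) = D" unfolding D_def by (rule det) fact+
    have D0: "D > 0" unfolding D_def using abc ABC pqr by (intro add_pos_pos mult_pos_pos)
    let ?t1 = "T1 x" and ?t2 = "T2 y" and ?t3 = "T3 z"
    have N: "N t = exp (- t\<^sup>2 / 2 - ln (2 * pi) / 2)" for t
      by (simp add: N_def std_normal_density_def exp_diff ln_sqrt[symmetric] exp_minus)
    have "f x = p x * N ?t1" "g y = q y * N ?t2" "h z = r z * N ?t3"
      using N0[of ?t1] N0[of ?t2] N0[of ?t3] by (auto simp: p_def q_def r_def)
    then have "f x powr a * g y powr b * h z powr c =
      (p x powr a * q y powr b * r z powr c) * (N ?t1 powr a * N ?t2 powr b * N ?t3 powr c)"
      using pqr N0 by (simp add: powr_mult less_imp_le)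
    also have "\<dots> \<le> (K * D) * (N (\<theta>1 v) * N (\<theta>2 v))"
    proof (rule mult_mono)
      show "p x powr a * q y powr b * r z powr c \<le> K * D"
        unfolding D_def by (intro det_ge pqr)
      have "(\<theta>1 v)\<^sup>2 + (\<theta>2 v)\<^sup>2 \<le> a * ?t1\<^sup>2 + b * ?t2\<^sup>2 + c * ?t3\<^sup>2"
      proof -
        \<comment> \<open>expand with \<open>a + b c A\<^sup>2 = 1\<close> and \<open>b C\<^sup>2 + c B\<^sup>2 = 1\<close> inserted, so that what follows is a ring identity\<close>
        have "a * ?t1\<^sup>2 + b * ?t2\<^sup>2 + c * ?t3\<^sup>2 = a * (a + b * c * A\<^sup>2) * ?t1\<^sup>2
            + b * (c * B\<^sup>2 * (a + b * c * A\<^sup>2) + b * C\<^sup>2) * ?t2\<^sup>2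
            + c * (b * C\<^sup>2 * (a + b * c * A\<^sup>2) + c * B\<^sup>2) * ?t3\<^sup>2
            + 2 * b * c * B * C * (1 - (a + b * c * A\<^sup>2)) * ?t2 * ?t3"
          using one sq by (simp add: add.commute)
        also have "\<dots> = (\<theta>1 v)\<^sup>2 + (\<theta>2 v)\<^sup>2 + a * b * c * (A * ?t1 + B * ?t2 - C * ?t3)\<^sup>2"
          unfolding \<theta>1_def \<theta>2_def xyz by (simp add: power2_eq_square algebra_simps)
        finally show ?thesis using abc by simp
      qed
      \<comment> \<open>Since \<open>a + b + c = 2\<close>, the normalising constants are those of
        two Gaussian factors, and only the quadratic forms have to be compared.\<close>
      moreover have "N ?t1 powr a * N ?t2 powr b * N ?t3 powr c
          = exp (- (a * ?t1\<^sup>2 + b * ?t2\<^sup>2 + c * ?t3\<^sup>2) / 2 - (a + b + c) * (ln (2 * pi) / 2))"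
        by (simp add: N powr_def flip: exp_add) (simp add: field_simps)
      moreover have "N (\<theta>1 v) * N (\<theta>2 v) = exp (- ((\<theta>1 v)\<^sup>2 + (\<theta>2 v)\<^sup>2) / 2 - 2 * (ln (2 * pi) / 2))"
        by (simp add: N flip: exp_add)
      ultimately show "N ?t1 powr a * N ?t2 powr b * N ?t3 powr c \<le> N (\<theta>1 v) * N (\<theta>2 v)"
        using abc by simp
    qed (use K0 D0 in auto)
    also have "\<dots> = \<bar>det (matrix (\<Theta>' v))\<bar> * G (\<Theta> v)"
      using D0 by (simp add: D G_def comp)
    finally show ?thesis .
  qed
  have [measurable]: "f \<in> borel_measurable borel" "g \<in> borel_measurable borel" "h \<in> borel_measurable borel"
    using f(1) g(1) h(1) by (auto intro: borel_measurable_continuous_onI)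
  have "(\<integral>\<^sup>+x. \<integral>\<^sup>+y. ennreal (f x powr a * g y powr b * h (x + y) powr c) \<partial>lborel \<partial>lborel)
    = (\<integral>\<^sup>+(v::real ^ 2). ennreal (f (v $ 1) powr a * g (v $ 2) powr b * h (v $ 1 + v $ 2) powr c) \<partial>lborel)"
    by (subst nn_integral_lborel_vec2) simp_all
  also have "\<dots> \<le> (\<integral>\<^sup>+v. ennreal (\<bar>det (matrix (\<Theta>' v))\<bar> * G (\<Theta> v)) \<partial>lborel)"
    by (intro nn_integral_mono ennreal_leI bound) auto
  also have "\<dots> \<le> (\<integral>\<^sup>+v. ennreal (G v) \<partial>lborel)"
    by (rule nn_integral_change_of_variables_le[OF der inj Gm])
      (use K0 N0 in \<open>auto simp: G_def iG[unfolded G_def] less_imp_le\<close>)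
  finally show ?thesis by (simp add: iG K_def)
qed

section \<open>From continuous probability densities to integrable functions\<close>

text \<open>Both sides are homogeneous of degrees \<open>a\<close>, \<open>b\<close>,
  \<open>c\<close> in \<open>f\<close>, \<open>g\<close>, \<open>h\<close>, so each function may be
  scaled to integral 1.\<close>

lemma brascamp_lieb_line_positive:
  fixes f g h :: "real \<Rightarrow> real"
  assumes abc: "0 < a" "a < 1" "0 < b" "b < 1" "0 < c" "c < 1" "a + b + c = 2"
    and f: "continuous_on UNIV f" "\<And>x. f x > 0" "integrable lborel f"
    and g: "continuous_on UNIV g" "\<And>x. g x > 0" "integrable lborel g"
    and h: "continuous_on UNIV h" "\<And>x. h x > 0" "integrable lborel h"
  shows "(\<integral>\<^sup>+x. \<integral>\<^sup>+y. ennreal (f x powr a * g y powr b * h (x + y) powr c) \<partial>lborel \<partial>lborel)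
    \<le> ennreal (young_const a b c * ((LINT x|lborel. f x) powr a * (LINT x|lborel. g x) powr b * (LINT x|lborel. h x) powr c))"
proof -
  have pos: "(LINT x|lborel. k x) > 0" if "\<And>x. k x > 0" "integrable lborel k" for k :: "real \<Rightarrow> real"
  proof -
    have "(LINT x|lborel. k x) \<noteq> 0"
      using that integral_nonneg_eq_0_iff_AE[OF that(2)]
      by (auto simp: less_imp_le less_imp_neq[symmetric] eventually_False ae_filter_eq_bot_iff)
    moreover have "(LINT x|lborel. k x) \<ge> 0" using that by (intro integral_nonneg_AE) (auto simp: less_imp_le)
    ultimately show ?thesis by simp
  qed
  have normalised: "(\<integral>\<^sup>+x. ennreal (k x / (LINT x|lborel. k x)) \<partial>lborel) = 1"
    if "\<And>x. k x > 0" "integrable lborel k" for k :: "real \<Rightarrow> real"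
  proof -
    have "(\<integral>\<^sup>+x. ennreal (k x / (LINT x|lborel. k x)) \<partial>lborel) = ennreal (LINT x|lborel. k x / (LINT x|lborel. k x))"
      using that pos[OF that] by (intro nn_integral_eq_integral integrable_divide) (auto simp: less_imp_le)
    then show ?thesis using pos[OF that] by simp
  qed
  define F where "F = (LINT x|lborel. f x)"
  define G where "G = (LINT x|lborel. g x)"
  define H where "H = (LINT x|lborel. h x)"
  have FGH: "F > 0" "G > 0" "H > 0" using pos f g h by (auto simp: F_def G_def H_def)
  have [measurable]: "f \<in> borel_measurable borel" "g \<in> borel_measurable borel" "h \<in> borel_measurable borel"
    using f(1) g(1) h(1) by (auto intro: borel_measurable_continuous_onI)
  define R where "R = F powr a * G powr b * H powr c"
  have R0: "R \<ge> 0" by (simp add: R_def)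
  have "(\<integral>\<^sup>+x. \<integral>\<^sup>+y. ennreal ((f x / F) powr a * (g y / G) powr b * (h (x + y) / H) powr c) \<partial>lborel \<partial>lborel)
    \<le> ennreal (young_const a b c)"
    using f g h FGH normalised[of f, folded F_def] normalised[of g, folded G_def] normalised[of h, folded H_def]
    by (intro brascamp_lieb_line_continuous abc continuous_intros) auto
  then have "ennreal R * (\<integral>\<^sup>+x. \<integral>\<^sup>+y. ennreal ((f x / F) powr a * (g y / G) powr b * (h (x + y) / H) powr c) \<partial>lborel \<partial>lborel)
    \<le> ennreal R * ennreal (young_const a b c)"
    by (rule mult_left_mono) simp
  also have "ennreal R * (\<integral>\<^sup>+x. \<integral>\<^sup>+y. ennreal ((f x / F) powr a * (g y / G) powr b * (h (x + y) / H) powr c) \<partial>lborel \<partial>lborel)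
    = (\<integral>\<^sup>+x. \<integral>\<^sup>+y. ennreal R * ennreal ((f x / F) powr a * (g y / G) powr b * (h (x + y) / H) powr c) \<partial>lborel \<partial>lborel)"
    by (simp add: nn_integral_cmult)
  also have "\<dots> = (\<integral>\<^sup>+x. \<integral>\<^sup>+y. ennreal (f x powr a * g y powr b * h (x + y) powr c) \<partial>lborel \<partial>lborel)"
  proof (intro nn_integral_cong)
    fix x y
    have "f x > 0" "g y > 0" "h (x + y) > 0" using f g h by auto
    then show "ennreal R * ennreal ((f x / F) powr a * (g y / G) powr b * (h (x + y) / H) powr c) =
      ennreal (f x powr a * g y powr b * h (x + y) powr c)"
      using FGH by (subst ennreal_mult[symmetric]) (auto simp: R_def powr_divide)
  qed
  also have "ennreal R * ennreal (young_const a b c) = ennreal (young_const a b c * R)"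
    using R0 by (metis ennreal_mult' mult.commute)
  finally show ?thesis by (simp only: R_def F_def G_def H_def)
qed

text \<open>Fatou's lemma, applied to the inner and then to the outer integral, controls the left
  side; the right side converges by continuity of \<open>powr\<close> for positive
  exponents.\<close>

lemma brascamp_lieb_line_limit:
  fixes f g h :: "real \<Rightarrow> real" and f' g' h' :: "nat \<Rightarrow> real \<Rightarrow> real"
  assumes abc: "0 < a" "0 < b" "0 < c"
    and [measurable]: "f \<in> borel_measurable borel" "g \<in> borel_measurable borel" "h \<in> borel_measurable borel"
      "\<And>n. f' n \<in> borel_measurable borel" "\<And>n. g' n \<in> borel_measurable borel" "\<And>n. h' n \<in> borel_measurable borel"
    and nonneg: "\<And>n x. f' n x \<ge> 0" "\<And>n x. g' n x \<ge> 0" "\<And>n x. h' n x \<ge> 0"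
    and lim: "AE x in lborel. (\<lambda>n. f' n x) \<longlonglongrightarrow> f x" "AE x in lborel. (\<lambda>n. g' n x) \<longlonglongrightarrow> g x"
      "AE x in lborel. (\<lambda>n. h' n x) \<longlonglongrightarrow> h x"
    and ilim: "(\<lambda>n. LINT x|lborel. f' n x) \<longlonglongrightarrow> F" "(\<lambda>n. LINT x|lborel. g' n x) \<longlonglongrightarrow> G"
      "(\<lambda>n. LINT x|lborel. h' n x) \<longlonglongrightarrow> H"
    and le: "\<And>n. (\<integral>\<^sup>+x. \<integral>\<^sup>+y. ennreal (f' n x powr a * g' n y powr b * h' n (x + y) powr c) \<partial>lborel \<partial>lborel)
    \<le> ennreal (K * ((LINT x|lborel. f' n x) powr a * (LINT x|lborel. g' n x) powr b * (LINT x|lborel. h' n x) powr c))"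
  shows "(\<integral>\<^sup>+x. \<integral>\<^sup>+y. ennreal (f x powr a * g y powr b * h (x + y) powr c) \<partial>lborel \<partial>lborel)
    \<le> ennreal (K * (F powr a * G powr b * H powr c))"
proof -
  define u where "u n x y = ennreal (f' n x powr a * g' n y powr b * h' n (x + y) powr c)" for n x y
  define R where "R n = ennreal (K * ((LINT x|lborel. f' n x) powr a * (LINT x|lborel. g' n x) powr b * (LINT x|lborel. h' n x) powr c))" for n
  have [measurable]: "(\<lambda>(x, y). u n x y) \<in> borel_measurable (lborel \<Otimes>\<^sub>M lborel)" for n
    unfolding u_def by measurable
  have [measurable]: "u n x \<in> borel_measurable lborel" for n x
    unfolding u_def by measurable
  have powr_lim: "(\<lambda>n. s n powr e) \<longlonglongrightarrow> t powr e" if "s \<longlonglongrightarrow> t" "\<And>n. s n \<ge> 0" "0 < e" for s t and e :: real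
    using that by (intro tendsto_powr') auto
  \<comment> \<open>For every \<open>x\<close>, the exceptional null set of \<open>h\<close> is
    translated by \<open>x\<close> and stays null.\<close>
  have shift: "AE y in lborel. (\<lambda>n. h' n (x + y)) \<longlonglongrightarrow> h (x + y)" for x
    using AE_borel_affine[of 1 "\<lambda>y. (\<lambda>n. h' n y) \<longlonglongrightarrow> h y" x] lim(3) by simp
  have pt: "AE x in lborel. AE y in lborel. ennreal (f x powr a * g y powr b * h (x + y) powr c) = liminf (\<lambda>n. u n x y)"
    using lim(1)
  proof eventually_elim
    case (elim x)
    from lim(2) shift[of x] show ?case
    proof eventually_elim
      case (elim y)
      have "(\<lambda>n. u n x y) \<longlonglongrightarrow> ennreal (f x powr a * g y powr b * h (x + y) powr c)"
        unfolding u_def using elim \<open>(\<lambda>n. f' n x) \<longlonglongrightarrow> f x\<close> abc nonneg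
        by (intro tendsto_ennrealI tendsto_mult powr_lim)
      then show ?case by (simp add: lim_imp_Liminf)
    qed
  qed
  have "(\<integral>\<^sup>+x. \<integral>\<^sup>+y. ennreal (f x powr a * g y powr b * h (x + y) powr c) \<partial>lborel \<partial>lborel)
    = (\<integral>\<^sup>+x. \<integral>\<^sup>+y. liminf (\<lambda>n. u n x y) \<partial>lborel \<partial>lborel)"
    using pt by (intro nn_integral_cong_AE) (auto elim!: eventually_mono intro!: nn_integral_cong_AE)
  also have "\<dots> \<le> (\<integral>\<^sup>+x. liminf (\<lambda>n. \<integral>\<^sup>+y. u n x y \<partial>lborel) \<partial>lborel)"
    by (intro nn_integral_mono nn_integral_liminf) simp
  also have "\<dots> \<le> liminf (\<lambda>n. \<integral>\<^sup>+x. \<integral>\<^sup>+y. u n x y \<partial>lborel \<partial>lborel)"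
    by (intro nn_integral_liminf) measurable
  also have "\<dots> \<le> liminf R"
    using le by (intro Liminf_mono) (auto simp: u_def R_def)
  also have "R \<longlonglongrightarrow> ennreal (K * (F powr a * G powr b * H powr c))"
    unfolding R_def using ilim nonneg abc
    by (intro tendsto_ennrealI tendsto_mult tendsto_const powr_lim integral_nonneg_AE) auto
  then have "liminf R = ennreal (K * (F powr a * G powr b * H powr c))"
    by (simp add: lim_imp_Liminf)
  finally show ?thesis .
qed

text \<open>A measurable function is almost everywhere a limit of continuous ones. Clamping these
  between 0 and \<open>w\<close> keeps the limit and gives domination by \<open>2 * w\<close> after
  \<open>w / (n + 1)\<close> is added to make them positive.\<close>

lemma continuous_positive_approximation:
  fixes f w :: "real \<Rightarrow> real"
  assumes [measurable]: "f \<in> borel_measurable borel"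
    and w: "continuous_on UNIV w" "\<And>x. 0 < w x" "integrable lborel w"
    and f: "\<And>x. 0 \<le> f x" "\<And>x. f x \<le> w x"
  obtains f' :: "nat \<Rightarrow> real \<Rightarrow> real"
  where "\<And>n. continuous_on UNIV (f' n)" "\<And>n x. f' n x > 0" "\<And>n. integrable lborel (f' n)"
    "AE x in lborel. (\<lambda>n. f' n x) \<longlonglongrightarrow> f x" "(\<lambda>n. LINT x|lborel. f' n x) \<longlonglongrightarrow> (LINT x|lborel. f x)"
proof -
  have [measurable]: "w \<in> borel_measurable borel"
    using w(1) by (rule borel_measurable_continuous_onI)
  have "f measurable_on UNIV"
    by (intro lebesgue_measurable_imp_measurable_on measurable_completion) auto
  then obtain N g where N: "negligible N" and g: "\<And>n. continuous_on UNIV (g n)"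
    and conv: "\<And>x. x \<notin> N \<Longrightarrow> (\<lambda>n. g n x) \<longlonglongrightarrow> f x"
    by (auto simp: measurable_on_def)
  define f' where "f' n x = max 0 (min (g n x) (w x)) + w x / real (Suc n)" for n x
  have [measurable]: "g n \<in> borel_measurable borel" for n
    using g by (rule borel_measurable_continuous_onI)
  have cont: "continuous_on UNIV (f' n)" for n
    unfolding f'_def by (intro continuous_intros g w) auto
  have pos: "f' n x > 0" for n x
    using w(2)[of x] unfolding f'_def by (intro add_nonneg_pos) auto
  have bound: "\<bar>f' n x\<bar> \<le> 2 * w x" for n x
  proof -
    have "w x / real (Suc n) \<le> w x" using w(2)[of x] by (simp add: divide_le_eq)
    then show ?thesis using pos[of n x] w(2)[of x] unfolding f'_def by auto
  qed
  have m[measurable]: "f' n \<in> borel_measurable borel" for n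
    using cont by (rule borel_measurable_continuous_onI)
  have w2: "integrable lborel (\<lambda>x. 2 * w x)" using w(3) by simp
  have int: "integrable lborel (f' n)" for n
    by (rule Bochner_Integration.integrable_bound[OF w2]) (use bound in \<open>auto intro!: AE_I2 intro: order_trans[OF _ abs_ge_self]\<close>)
  have "AE x in lebesgue. x \<notin> N"
    using N by (intro AE_not_in) (simp add: negligible_iff_null_sets)
  then have "AE x in lborel. x \<notin> N" by (simp add: AE_completion_iff)
  then have lim: "AE x in lborel. (\<lambda>n. f' n x) \<longlonglongrightarrow> f x"
  proof eventually_elim
    case (elim x)
    have "(\<lambda>n. w x / real (Suc n)) \<longlonglongrightarrow> 0"
      by (rule LIMSEQ_Suc[OF lim_const_over_n])
    then have "(\<lambda>n. f' n x) \<longlonglongrightarrow> max 0 (min (f x) (w x)) + 0"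
      unfolding f'_def by (intro tendsto_intros conv elim)
    then show ?case using f[of x] by simp
  qed
  have "(\<lambda>n. LINT x|lborel. f' n x) \<longlonglongrightarrow> (LINT x|lborel. f x)"
    by (rule integral_dominated_convergence[where w = "\<lambda>x. 2 * w x"]) (use w2 lim bound in auto)
  with cont pos int lim that show thesis by blast
qed

text \<open>Two passages to the limit: the truncations at multiples of the Gaussian density lie
  below a continuous integrable function and can be approximated; then the truncation level tends to
  infinity, with the functions themselves as dominating functions.\<close>

lemma brascamp_lieb_line_integrable:
  fixes f g h :: "real \<Rightarrow> real"
  assumes abc: "0 < a" "a < 1" "0 < b" "b < 1" "0 < c" "c < 1" "a + b + c = 2"
    and f: "\<And>x. f x \<ge> 0" "integrable lborel f"
    and g: "\<And>x. g x \<ge> 0" "integrable lborel g"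
    and h: "\<And>x. h x \<ge> 0" "integrable lborel h"
  shows "(\<integral>\<^sup>+x. \<integral>\<^sup>+y. ennreal (f x powr a * g y powr b * h (x + y) powr c) \<partial>lborel \<partial>lborel)
    \<le> ennreal (young_const a b c * ((LINT x|lborel. f x) powr a * (LINT x|lborel. g x) powr b * (LINT x|lborel. h x) powr c))"
proof -
  define w where "w k x = real (Suc k) * std_normal_density x" for k x
  have w: "continuous_on UNIV (w k)" "0 < w k x" "integrable lborel (w k)" for k x
  proof -
    show "continuous_on UNIV (w k)"
      unfolding w_def std_normal_density_def by (intro continuous_intros) auto
    show "0 < w k x" unfolding w_def by (intro mult_pos_pos normal_density_pos) auto
    show "integrable lborel (w k)" unfolding w_def by (intro integrable_mult_right integrable_normal_density) auto
  qed
  have wlim: "LIM k sequentially. w k x :> at_top" for x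
    unfolding w_def by (intro filterlim_at_top_mult_tendsto_pos[OF tendsto_const] normal_density_pos
        filterlim_compose[OF filterlim_real_sequentially filterlim_Suc]) auto
  define t where "t k u x = min (u x) (w k x)" for k u and x :: real
  have t: "t k u \<in> borel_measurable borel" "0 \<le> t k u x" "t k u x \<le> w k x" "t k u x \<le> u x" "integrable lborel (t k u)"
    "(\<lambda>k. t k u x) \<longlonglongrightarrow> u x" "(\<lambda>k. LINT x|lborel. t k u x) \<longlonglongrightarrow> (LINT x|lborel. u x)"
    if u: "\<And>x. u x \<ge> 0" "integrable lborel u" for k u x
  proof -
    have [measurable]: "u \<in> borel_measurable borel" "w k \<in> borel_measurable borel" for k
      using u(2) w(3) by (auto dest: borel_measurable_integrable)
    show m[measurable]: "t k u \<in> borel_measurable borel" for k unfolding t_def by measurable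
    show b: "0 \<le> t k u x" "t k u x \<le> w k x" "t k u x \<le> u x" for k x using u(1)[of x] w(2)[of k x] by (auto simp: t_def)
    show "integrable lborel (t k u)"
      by (rule Bochner_Integration.integrable_bound[OF u(2)]) (use u(1) b in auto)
    show l: "(\<lambda>k. t k u x) \<longlonglongrightarrow> u x" for x
    proof (rule tendsto_eventually)
      have "\<forall>\<^sub>F k in sequentially. u x \<le> w k x" using wlim[of x] by (simp add: filterlim_at_top)
      then show "\<forall>\<^sub>F k in sequentially. t k u x = u x" by eventually_elim (simp add: t_def)
    qed
    show "(\<lambda>k. LINT x|lborel. t k u x) \<longlonglongrightarrow> (LINT x|lborel. u x)"
      by (rule integral_dominated_convergence[where w = u]) (use u l b in auto)
  qed
  have trunc: "(\<integral>\<^sup>+x. \<integral>\<^sup>+y. ennreal (t k f x powr a * t k g y powr b * t k h (x + y) powr c) \<partial>lborel \<partial>lborel)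
    \<le> ennreal (young_const a b c * ((LINT x|lborel. t k f x) powr a * (LINT x|lborel. t k g x) powr b * (LINT x|lborel. t k h x) powr c))" for k
  proof -
    obtain f' where f': "\<And>n. continuous_on UNIV (f' n)" "\<And>n x. f' n x > 0" "\<And>n. integrable lborel (f' n)"
      "AE x in lborel. (\<lambda>n. f' n x) \<longlonglongrightarrow> t k f x" "(\<lambda>n. LINT x|lborel. f' n x) \<longlonglongrightarrow> (LINT x|lborel. t k f x)"
      by (rule continuous_positive_approximation[OF t(1)[OF f] w t(2)[OF f] t(3)[OF f]]) blast
    obtain g' where g': "\<And>n. continuous_on UNIV (g' n)" "\<And>n x. g' n x > 0" "\<And>n. integrable lborel (g' n)"
      "AE x in lborel. (\<lambda>n. g' n x) \<longlonglongrightarrow> t k g x" "(\<lambda>n. LINT x|lborel. g' n x) \<longlonglongrightarrow> (LINT x|lborel. t k g x)"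
      by (rule continuous_positive_approximation[OF t(1)[OF g] w t(2)[OF g] t(3)[OF g]]) blast
    obtain h' where h': "\<And>n. continuous_on UNIV (h' n)" "\<And>n x. h' n x > 0" "\<And>n. integrable lborel (h' n)"
      "AE x in lborel. (\<lambda>n. h' n x) \<longlonglongrightarrow> t k h x" "(\<lambda>n. LINT x|lborel. h' n x) \<longlonglongrightarrow> (LINT x|lborel. t k h x)"
      by (rule continuous_positive_approximation[OF t(1)[OF h] w t(2)[OF h] t(3)[OF h]]) blast
    show ?thesis
    proof (rule brascamp_lieb_line_limit[OF abc(1,3,5) t(1)[OF f] t(1)[OF g] t(1)[OF h] _ _ _ _ _ _
          f'(4) g'(4) h'(4) f'(5) g'(5) h'(5)])
      show "f' n \<in> borel_measurable borel" "g' n \<in> borel_measurable borel" "h' n \<in> borel_measurable borel" for n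
        using f'(1) g'(1) h'(1) by (auto intro: borel_measurable_continuous_onI)
      show "f' n x \<ge> 0" "g' n x \<ge> 0" "h' n x \<ge> 0" for n x
        using f'(2) g'(2) h'(2) by (auto intro: less_imp_le)
    qed (rule brascamp_lieb_line_positive[OF abc f'(1,2,3) g'(1,2,3) h'(1,2,3)])
  qed
  have m: "f \<in> borel_measurable borel" "g \<in> borel_measurable borel" "h \<in> borel_measurable borel"
    using f(2) g(2) h(2) by (auto dest: borel_measurable_integrable)
  show ?thesis
    by (rule brascamp_lieb_line_limit[OF abc(1,3,5) m t(1)[OF f] t(1)[OF g] t(1)[OF h] t(2)[OF f] t(2)[OF g] t(2)[OF h]
        AE_I2[OF t(6)[OF f]] AE_I2[OF t(6)[OF g]] AE_I2[OF t(6)[OF h]] t(7)[OF f] t(7)[OF g] t(7)[OF h] trunc])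
qed

section \<open>Extended nonnegative functions and several dimensions\<close>

text \<open>Meant for positive exponents. The value at \<open>\<top>\<close> is set separately
  because \<open>enn2real \<top> = 0\<close>.\<close>

definition ennreal_powr :: "ennreal \<Rightarrow> real \<Rightarrow> ennreal" (infixr "powr\<^sub>e" 80) where
  "x powr\<^sub>e a = (if x = \<top> then \<top> else ennreal (enn2real x powr a))"

lemma ennreal_powr_simps [simp]:
  "0 powr\<^sub>e a = 0" "\<top> powr\<^sub>e a = \<top>" "0 \<le> x \<Longrightarrow> ennreal x powr\<^sub>e a = ennreal (x powr a)"
  by (auto simp: ennreal_powr_def)

lemma measurable_ennreal_powr [measurable]:
  assumes [measurable]: "f \<in> borel_measurable M"
  shows "(\<lambda>x. f x powr\<^sub>e a) \<in> borel_measurable M"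
  unfolding ennreal_powr_def by measurable

lemma ennreal_powr_eq_0_iff: "x powr\<^sub>e a = 0 \<longleftrightarrow> x = 0"
  by (cases x) (auto simp: ennreal_eq_0_iff)

lemma brascamp_lieb_line:
  fixes f g h :: "real \<Rightarrow> ennreal"
  assumes abc: "0 < a" "a < 1" "0 < b" "b < 1" "0 < c" "c < 1" "a + b + c = 2"
    and [measurable]: "f \<in> borel_measurable borel" "g \<in> borel_measurable borel" "h \<in> borel_measurable borel"
  shows "(\<integral>\<^sup>+x. \<integral>\<^sup>+y. f x powr\<^sub>e a * g y powr\<^sub>e b * h (x + y) powr\<^sub>e c \<partial>lborel \<partial>lborel)
    \<le> ennreal (young_const a b c) * ((\<integral>\<^sup>+x. f x \<partial>lborel) powr\<^sub>e a * (\<integral>\<^sup>+x. g x \<partial>lborel) powr\<^sub>e b * (\<integral>\<^sup>+x. h x \<partial>lborel) powr\<^sub>e c)"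
    (is "?L \<le> ?K * (?F powr\<^sub>e a * ?G powr\<^sub>e b * ?H powr\<^sub>e c)")
proof -
  have shift: "AE y in lborel. P (x + y)" if "Measurable.pred borel P" "AE y in lborel. P y" for P and x :: real
    using AE_borel_affine[of 1 P x] that by simp
  have K0: "?K \<noteq> 0" by (simp add: young_const_def ennreal_eq_0_iff)
  consider "?F = 0" | "?G = 0" | "?H = 0" | "?F \<noteq> 0" "?G \<noteq> 0" "?H \<noteq> 0" "?F = \<top> \<or> ?G = \<top> \<or> ?H = \<top>"
    | "?F < \<top>" "?G < \<top>" "?H < \<top>" by (metis top.not_eq_extremum)
  then show ?thesis
  proof cases
    case 1
    then have "AE x in lborel. f x = 0" by (simp add: nn_integral_0_iff_AE)
    then have "?L = (\<integral>\<^sup>+(x::real). 0 \<partial>lborel)"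
      by (intro nn_integral_cong_AE) (auto elim!: eventually_mono)
    then show ?thesis by simp
  next
    case 2
    then have ae: "AE x in lborel. g x = 0" by (simp add: nn_integral_0_iff_AE)
    have "?L = (\<integral>\<^sup>+(x::real). \<integral>\<^sup>+(y::real). 0 \<partial>lborel \<partial>lborel)"
      by (rule nn_integral_cong, rule nn_integral_cong_AE, rule eventually_mono, rule ae) simp
    then show ?thesis by simp
  next
    case 3
    then have "AE x in lborel. h x = 0" by (simp add: nn_integral_0_iff_AE)
    then have ae: "AE y in lborel. h (x + y) = 0" for x by (intro shift) auto
    have "(\<integral>\<^sup>+y. f x powr\<^sub>e a * g y powr\<^sub>e b * h (x + y) powr\<^sub>e c \<partial>lborel) = (\<integral>\<^sup>+(y::real). 0 \<partial>lborel)" for x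
      by (rule nn_integral_cong_AE, rule eventually_mono[OF ae[of x]]) simp
    then have "?L = 0" by simp
    then show ?thesis by simp
  next
    case 4
    then have "?F powr\<^sub>e a * ?G powr\<^sub>e b * ?H powr\<^sub>e c = \<top>"
      by (auto simp: ennreal_mult_eq_top_iff ennreal_powr_eq_0_iff)
    then show ?thesis using K0 by (simp add: ennreal_mult_top)
  next
    case 5
    have real: "AE x in lborel. u x = ennreal (enn2real (u x))" "integrable lborel (\<lambda>x. enn2real (u x))"
      "(\<integral>\<^sup>+x. u x \<partial>lborel) = ennreal (LINT x|lborel. enn2real (u x))"
      if [measurable]: "u \<in> borel_measurable borel" and "(\<integral>\<^sup>+x. u x \<partial>lborel) < \<top>" for u :: "real \<Rightarrow> ennreal"
    proof -
      have "AE x in lborel. u x \<noteq> \<infinity>"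
        using that(2) by (intro nn_integral_PInf_AE) auto
      then show ae: "AE x in lborel. u x = ennreal (enn2real (u x))"
        by eventually_elim (simp add: less_top)
      have eq: "(\<integral>\<^sup>+x. u x \<partial>lborel) = (\<integral>\<^sup>+x. ennreal (enn2real (u x)) \<partial>lborel)"
        by (rule nn_integral_cong_AE[OF ae])
      show i: "integrable lborel (\<lambda>x. enn2real (u x))"
        using eq that(2) by (intro integrableI_bounded) auto
      show "(\<integral>\<^sup>+x. u x \<partial>lborel) = ennreal (LINT x|lborel. enn2real (u x))"
        unfolding eq by (rule nn_integral_eq_integral[OF i]) simp
    qed
    have f: "f \<in> borel_measurable borel" and g: "g \<in> borel_measurable borel" and h: "h \<in> borel_measurable borel"
      by measurable
    note rf = real[OF f 5(1)] and rg = real[OF g 5(2)] and rh = real[OF h 5(3)]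
    have rhs: "AE y in lborel. h (x + y) = ennreal (enn2real (h (x + y)))" for x
      by (rule shift[OF _ rh(1)]) measurable
    have "?L = (\<integral>\<^sup>+x. \<integral>\<^sup>+y. ennreal (enn2real (f x) powr a * enn2real (g y) powr b * enn2real (h (x + y)) powr c) \<partial>lborel \<partial>lborel)"
    proof (rule nn_integral_cong_AE, use rf(1) in eventually_elim)
      case fx: (elim x)
      show ?case
      proof (rule nn_integral_cong_AE, use rg(1) rhs[of x] in eventually_elim)
        case (elim y)
        show ?case
          by (subst fx, subst elim(1), subst elim(2)) (simp add: ennreal_mult)
      qed
    qed
    also have "\<dots> \<le> ennreal (young_const a b c * ((LINT x|lborel. enn2real (f x)) powr a * (LINT x|lborel. enn2real (g x)) powr b * (LINT x|lborel. enn2real (h x)) powr c))"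
      by (rule brascamp_lieb_line_integrable[OF abc _ rf(2) _ rg(2) _ rh(2)]) auto
    also have "\<dots> = ?K * (?F powr\<^sub>e a * ?G powr\<^sub>e b * ?H powr\<^sub>e c)"
      unfolding rf(3) rg(3) rh(3) by (simp add: ennreal_mult integral_nonneg_AE young_const_def)
    finally show ?thesis .
  qed
qed

text \<open>Induction on the set of coordinates: with the coordinates \<open>s\<close> and
  \<open>t\<close> at \<open>j\<close> fixed, the hypothesis applies to the sections; the line
  inequality then applies to the marginals \<open>F\<close>, \<open>G\<close>, \<open>H\<close>.
  Each coordinate contributes one factor of the constant. The sum is restricted to \<open>I\<close>
  so as to stay in the space of the product measure.\<close>

lemma brascamp_lieb_PiM:
  fixes f g h :: "('i \<Rightarrow> real) \<Rightarrow> ennreal"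
  assumes abc: "0 < a" "a < 1" "0 < b" "b < 1" "0 < c" "c < 1" "a + b + c = 2"
    and "finite I"
    and "f \<in> borel_measurable (\<Pi>\<^sub>M i\<in>I. lborel)" "g \<in> borel_measurable (\<Pi>\<^sub>M i\<in>I. lborel)"
      "h \<in> borel_measurable (\<Pi>\<^sub>M i\<in>I. lborel)"
  shows "(\<integral>\<^sup>+x. \<integral>\<^sup>+y. f x powr\<^sub>e a * g y powr\<^sub>e b * h (\<lambda>i\<in>I. x i + y i) powr\<^sub>e c
      \<partial>(\<Pi>\<^sub>M i\<in>I. lborel) \<partial>(\<Pi>\<^sub>M i\<in>I. lborel))
    \<le> ennreal (young_const a b c) ^ card I * ((\<integral>\<^sup>+x. f x \<partial>(\<Pi>\<^sub>M i\<in>I. lborel)) powr\<^sub>e a *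
      (\<integral>\<^sup>+x. g x \<partial>(\<Pi>\<^sub>M i\<in>I. lborel)) powr\<^sub>e b * (\<integral>\<^sup>+x. h x \<partial>(\<Pi>\<^sub>M i\<in>I. lborel)) powr\<^sub>e c)"
  using assms(8-)
proof (induction I arbitrary: f g h rule: finite_induct)
  case empty
  interpret product_sigma_finite "\<lambda>_::'i. lborel :: real measure" ..
  have "(\<lambda>i\<in>{}. x i + y i) = (\<lambda>_. undefined)" for x y :: "'i \<Rightarrow> real" by auto
  then show ?case by (simp add: nn_integral_empty)
next
  case (insert j I)
  interpret product_sigma_finite "\<lambda>_::'i. lborel :: real measure" ..
  let ?P = "\<Pi>\<^sub>M i\<in>I. (lborel :: real measure)"
  let ?Q = "\<Pi>\<^sub>M i\<in>insert j I. (lborel :: real measure)"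
  let ?K = "ennreal (young_const a b c)"
  interpret P: sigma_finite_measure ?P by (rule sigma_finite) fact
  interpret Q: sigma_finite_measure ?Q by (rule sigma_finite) (use insert in auto)
  interpret LP: pair_sigma_finite "lborel :: real measure" ?P ..
  note [measurable] = insert.prems
  define F where "F s = (\<integral>\<^sup>+x. f (x(j := s)) \<partial>?P)" for s
  define G where "G s = (\<integral>\<^sup>+x. g (x(j := s)) \<partial>?P)" for s
  define H where "H s = (\<integral>\<^sup>+x. h (x(j := s)) \<partial>?P)" for s
  have [measurable]: "F \<in> borel_measurable borel" "G \<in> borel_measurable borel" "H \<in> borel_measurable borel"
    unfolding F_def G_def H_def by measurable
  have FGH: "(\<integral>\<^sup>+x. f x \<partial>?Q) = (\<integral>\<^sup>+s. F s \<partial>lborel)" "(\<integral>\<^sup>+x. g x \<partial>?Q) = (\<integral>\<^sup>+s. G s \<partial>lborel)"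
    "(\<integral>\<^sup>+x. h x \<partial>?Q) = (\<integral>\<^sup>+s. H s \<partial>lborel)"
    unfolding F_def G_def H_def using insert.hyps by (simp_all add: product_nn_integral_insert_rev)
  let ?u = "\<lambda>x y. f x powr\<^sub>e a * g y powr\<^sub>e b * h (\<lambda>i\<in>insert j I. x i + y i) powr\<^sub>e c"
  have upd: "(\<lambda>i\<in>insert j I. (x(j := s)) i + (y(j := t)) i) = (\<lambda>i\<in>I. x i + y i)(j := s + t)" for x y s t
    using insert.hyps by (auto simp: fun_eq_iff restrict_def)
  have [measurable]: "(\<lambda>(x, y). ?u x y) \<in> borel_measurable (?Q \<Otimes>\<^sub>M ?Q)" by measurable
  have "(\<integral>\<^sup>+x. \<integral>\<^sup>+y. ?u x y \<partial>?Q \<partial>?Q) = (\<integral>\<^sup>+s. \<integral>\<^sup>+x. \<integral>\<^sup>+t. \<integral>\<^sup>+y. ?u (x(j := s)) (y(j := t)) \<partial>?P \<partial>lborel \<partial>?P \<partial>lborel)"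
    (is "_ = ?R")
  proof -
    have "(\<integral>\<^sup>+x. \<integral>\<^sup>+y. ?u x y \<partial>?Q \<partial>?Q) = (\<integral>\<^sup>+s. \<integral>\<^sup>+x. \<integral>\<^sup>+y. ?u (x(j := s)) y \<partial>?Q \<partial>?P \<partial>lborel)"
      using insert.hyps by (intro product_nn_integral_insert_rev) auto
    also have "\<dots> = ?R"
      using insert.hyps by (intro nn_integral_cong product_nn_integral_insert_rev) measurable
    finally show ?thesis .
  qed
  also have "\<dots> = (\<integral>\<^sup>+s. \<integral>\<^sup>+t. \<integral>\<^sup>+x. \<integral>\<^sup>+y. ?u (x(j := s)) (y(j := t)) \<partial>?P \<partial>?P \<partial>lborel \<partial>lborel)"
    by (intro nn_integral_cong LP.Fubini') measurable
  also have "\<dots> \<le> (\<integral>\<^sup>+s. \<integral>\<^sup>+t. ?K ^ card I * (F s powr\<^sub>e a * G t powr\<^sub>e b * H (s + t) powr\<^sub>e c) \<partial>lborel \<partial>lborel)"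
    unfolding upd F_def G_def H_def
    by (intro nn_integral_mono insert.IH) measurable
  also have "\<dots> = ?K ^ card I * (\<integral>\<^sup>+s. \<integral>\<^sup>+t. F s powr\<^sub>e a * G t powr\<^sub>e b * H (s + t) powr\<^sub>e c \<partial>lborel \<partial>lborel)"
    by (simp add: nn_integral_cmult)
  also have "\<dots> \<le> ?K ^ card I * (?K * ((\<integral>\<^sup>+s. F s \<partial>lborel) powr\<^sub>e a * (\<integral>\<^sup>+s. G s \<partial>lborel) powr\<^sub>e b * (\<integral>\<^sup>+s. H s \<partial>lborel) powr\<^sub>e c))"
    by (intro mult_left_mono brascamp_lieb_line abc) auto
  also have "\<dots> = ?K ^ card (insert j I) * ((\<integral>\<^sup>+x. f x \<partial>?Q) powr\<^sub>e a * (\<integral>\<^sup>+x. g x \<partial>?Q) powr\<^sub>e b * (\<integral>\<^sup>+x. h x \<partial>?Q) powr\<^sub>e c)"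
    using insert.hyps by (simp add: FGH ac_simps)
  finally show ?case .
qed

text \<open>Lebesgue measure is the image of the product measure under the coordinate map
  \<open>e\<close>, which respects addition.\<close>

lemma brascamp_lieb_euclidean:
  fixes f g h :: "'a::euclidean_space \<Rightarrow> ennreal"
  assumes abc: "0 < a" "a < 1" "0 < b" "b < 1" "0 < c" "c < 1" "a + b + c = 2"
    and [measurable]: "f \<in> borel_measurable borel" "g \<in> borel_measurable borel" "h \<in> borel_measurable borel"
  shows "(\<integral>\<^sup>+x. \<integral>\<^sup>+y. f x powr\<^sub>e a * g y powr\<^sub>e b * h (x + y) powr\<^sub>e c \<partial>lborel \<partial>lborel)
    \<le> ennreal (young_const a b c) ^ DIM('a) * ((\<integral>\<^sup>+x. f x \<partial>lborel) powr\<^sub>e a * (\<integral>\<^sup>+x. g x \<partial>lborel) powr\<^sub>e b * (\<integral>\<^sup>+x. h x \<partial>lborel) powr\<^sub>e c)"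
proof -
  let ?P = "\<Pi>\<^sub>M i\<in>(Basis :: 'a set). (lborel :: real measure)"
  define e where "e x = (\<Sum>b\<in>Basis. x b *\<^sub>R b)" for x :: "'a \<Rightarrow> real"
  have [measurable]: "e \<in> measurable ?P borel" unfolding e_def by measurable
  have int: "(\<integral>\<^sup>+x. u x \<partial>lborel) = (\<integral>\<^sup>+x. u (e x) \<partial>?P)" if [measurable]: "u \<in> borel_measurable borel" for u :: "'a \<Rightarrow> ennreal"
    unfolding e_def by (subst lborel_eq) (simp add: nn_integral_distr)
  have add: "e x + e y = e (\<lambda>i\<in>Basis. x i + y i)" for x y
    by (simp add: e_def scaleR_add_left sum.distrib)
  have "(\<integral>\<^sup>+x. \<integral>\<^sup>+y. f x powr\<^sub>e a * g y powr\<^sub>e b * h (x + y) powr\<^sub>e c \<partial>lborel \<partial>lborel)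
    = (\<integral>\<^sup>+x. \<integral>\<^sup>+y. f (e x) powr\<^sub>e a * g (e y) powr\<^sub>e b * h (e (\<lambda>i\<in>Basis. x i + y i)) powr\<^sub>e c \<partial>?P \<partial>?P)"
    by (subst int, measurable) (simp add: int add)
  also have "\<dots> \<le> ennreal (young_const a b c) ^ card (Basis :: 'a set) *
    ((\<integral>\<^sup>+x. f (e x) \<partial>?P) powr\<^sub>e a * (\<integral>\<^sup>+x. g (e x) \<partial>?P) powr\<^sub>e b * (\<integral>\<^sup>+x. h (e x) \<partial>?P) powr\<^sub>e c)"
    by (rule brascamp_lieb_PiM[OF abc]) measurable
  finally show ?thesis by (simp add: int)
qed

section \<open>Consequence for the density of a sum\<close>

text \<open>Write \<open>q = (1 - s) + s * p\<close>. Both \<open>f\<close> and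
  \<open>f powr p / A\<close> have integral 1, so the pointwise Young inequality with weights
  \<open>1 - s\<close> and \<open>s\<close> integrates to the bound.\<close>

lemma nn_integral_powr_interpolation:
  fixes f :: "'a \<Rightarrow> real"
  assumes [measurable]: "f \<in> borel_measurable M" and nn: "\<And>x. f x \<ge> 0"
    and one: "(\<integral>\<^sup>+x. ennreal (f x) \<partial>M) = 1"
    and p: "(\<integral>\<^sup>+x. ennreal (f x powr p) \<partial>M) = ennreal A" "A > 0"
    and q: "1 < q" "q < p"
  shows "(\<integral>\<^sup>+x. ennreal (f x powr q) \<partial>M) \<le> ennreal (A powr ((q - 1) / (p - 1)))"
proof -
  define s where "s = (q - 1) / (p - 1)"
  have s: "0 < s" "s < 1" using q by (auto simp: s_def)
  have sq: "q = (1 - s) + p * s"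
  proof -
    have "s * (p - 1) = q - 1" using q by (simp add: s_def)
    then show ?thesis by (simp add: algebra_simps)
  qed
  have "f x powr q \<le> A powr s * ((1 - s) * f x + s * (f x powr p / A))" for x
  proof (cases "f x = 0")
    case False
    with nn[of x] have x: "f x > 0" by simp
    have "f x powr (1 - s) * (f x powr p / A) powr s \<le> (1 - s) * f x + s * (f x powr p / A)"
      using s x p(2) by (intro Youngs_inequality_0) auto
    also have "f x powr (1 - s) * (f x powr p / A) powr s = f x powr q / A powr s"
      using x p(2) by (simp add: powr_divide powr_powr sq powr_add)
    finally show ?thesis using p(2) by (simp add: pos_divide_le_eq mult.commute)
  qed (use s p q in auto)
  then have "(\<integral>\<^sup>+x. ennreal (f x powr q) \<partial>M) \<le> (\<integral>\<^sup>+x. ennreal (A powr s * ((1 - s) * f x + s * (f x powr p / A))) \<partial>M)"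
    by (intro nn_integral_mono ennreal_leI)
  also have "\<dots> = (\<integral>\<^sup>+x. ennreal (A powr s * (1 - s)) * ennreal (f x) + ennreal (A powr s * s / A) * ennreal (f x powr p) \<partial>M)"
  proof (rule nn_integral_cong)
    fix x
    have "ennreal (A powr s * (1 - s)) * ennreal (f x) + ennreal (A powr s * s / A) * ennreal (f x powr p)
        = ennreal (A powr s * (1 - s) * f x) + ennreal (A powr s * s / A * f x powr p)"
      using s p(2) nn[of x] by (intro arg_cong2[where f = "(+)"] ennreal_mult[symmetric]) auto
    also have "\<dots> = ennreal (A powr s * (1 - s) * f x + A powr s * s / A * f x powr p)"
      using s p(2) nn[of x] by (intro ennreal_plus[symmetric]) auto
    finally show "ennreal (A powr s * ((1 - s) * f x + s * (f x powr p / A))) =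
        ennreal (A powr s * (1 - s)) * ennreal (f x) + ennreal (A powr s * s / A) * ennreal (f x powr p)"
      by (simp add: algebra_simps)
  qed
  also have "\<dots> = ennreal (A powr s * (1 - s)) * 1 + ennreal (A powr s * s / A) * ennreal A"
    by (simp add: nn_integral_add nn_integral_cmult one p)
  also have "\<dots> = ennreal (A powr s)"
    using s p(2) by (simp add: algebra_simps flip: ennreal_mult ennreal_plus)
  finally show ?thesis by (simp add: s_def)
qed

text \<open>Apply the trilinear inequality to \<open>f powr (1 / a)\<close>,
  \<open>g powr (1 / b)\<close>, \<open>h powr p\<close>; since \<open>p * c = p - 1\<close>, its
  left side is the right side of \<open>conv\<close>. The weight \<open>l\<close> distributes
  \<open>c = (1 - a) + (1 - b)\<close> between the first two exponents.\<close>

lemma ln_powr_integral_convolution_le: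
  fixes f g h :: "'a::euclidean_space \<Rightarrow> real"
  assumes p: "p > 1" and l: "0 < l" "l < 1" and c: "c = (p - 1) / p"
    and [measurable]: "f \<in> borel_measurable borel" "g \<in> borel_measurable borel" "h \<in> borel_measurable borel"
    and nn: "\<And>x. f x \<ge> 0" "\<And>x. g x \<ge> 0" "\<And>x. h x \<ge> 0"
    and one: "(\<integral>\<^sup>+x. ennreal (f x) \<partial>lborel) = 1" "(\<integral>\<^sup>+x. ennreal (g x) \<partial>lborel) = 1"
    and F: "(\<integral>\<^sup>+x. ennreal (f x powr p) \<partial>lborel) = ennreal F" "F > 0"
    and G: "(\<integral>\<^sup>+x. ennreal (g x powr p) \<partial>lborel) = ennreal G" "G > 0"
    and H: "(\<integral>\<^sup>+x. ennreal (h x powr p) \<partial>lborel) = ennreal H" "H > 0"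
    and conv: "(\<integral>\<^sup>+x. ennreal (h x powr p) \<partial>lborel) =
      (\<integral>\<^sup>+x. \<integral>\<^sup>+y. ennreal (f x * g y * h (x + y) powr (p - 1)) \<partial>lborel \<partial>lborel)"
  shows "ln H \<le> p * DIM('a) * ln (young_const (1 - l * c) (1 - (1 - l) * c) c) + l * ln F + (1 - l) * ln G"
proof -
  define a where "a = 1 - l * c"
  define b where "b = 1 - (1 - l) * c"
  define K where "K = young_const a b c"
  have K0: "K > 0" by (simp add: K_def young_const_pos)
  have c01: "0 < c" "c < 1" using p by (auto simp: c)
  have "l * c < 1 * 1" "(1 - l) * c < 1 * 1" using l c01 by (intro mult_strict_mono; simp)+
  moreover have "l * c > 0" "(1 - l) * c > 0" using l c01 by auto
  ultimately have ab: "0 < a" "a < 1" "0 < b" "b < 1" by (auto simp: a_def b_def)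
  have sum: "a + b + c = 2" by (simp add: a_def b_def algebra_simps)
  \<comment> \<open>As \<open>1 - c = 1 / p\<close>, this places \<open>1 / a\<close> and
    \<open>1 / b\<close> strictly between 1 and \<open>p\<close>, the range of the
    interpolation.\<close>
  have c_lt: "1 - c < a" "1 - c < b" using l c01 by (auto simp: a_def b_def)
  have "1 - c = 1 / p" using p by (simp add: c field_simps)
  then have "1 < a * p" "1 < b * p"
    using c_lt p mult_strict_right_mono[of "1 - c" a p] mult_strict_right_mono[of "1 - c" b p] by auto
  then have q: "1 < 1 / a" "1 / a < p" "1 < 1 / b" "1 / b < p" using ab by (auto simp: field_simps)
  have pc: "p * c = p - 1" using p by (simp add: c)
  have ea: "((1 / a - 1) / (p - 1)) * a = l / p" "((1 / b - 1) / (p - 1)) * b = (1 - l) / p"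
  proof -
    have "((1 / a - 1) / (p - 1)) * a = (1 - a) / (p - 1)" using ab p by (simp add: field_simps)
    also have "\<dots> = l / p" using p by (simp add: a_def c field_simps)
    finally show "((1 / a - 1) / (p - 1)) * a = l / p" .
    have "((1 / b - 1) / (p - 1)) * b = (1 - b) / (p - 1)" using ab p by (simp add: field_simps)
    also have "\<dots> = (1 - l) / p" using p by (simp add: b_def c field_simps)
    finally show "((1 / b - 1) / (p - 1)) * b = (1 - l) / p" .
  qed
  have powr_mono_e: "u powr\<^sub>e e \<le> ennreal (v powr (w * e))" if "u \<le> ennreal (v powr w)" "0 < e" for u v w e
  proof -
    have "u \<noteq> \<top>" using that(1) by (auto simp: top_unique)
    then obtain r where r: "u = ennreal r" "r \<ge> 0" by (cases u) auto
    then have "r powr e \<le> (v powr w) powr e" using that by (intro powr_mono2) auto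
    then show ?thesis using r by (simp add: powr_powr ennreal_leI)
  qed
  have "ennreal H = (\<integral>\<^sup>+x. \<integral>\<^sup>+y. ennreal (f x powr (1 / a)) powr\<^sub>e a * ennreal (g y powr (1 / b)) powr\<^sub>e b * ennreal (h (x + y) powr p) powr\<^sub>e c \<partial>lborel \<partial>lborel)"
    using ab nn pc by (simp add: H(1)[symmetric] conv powr_powr ennreal_mult)
  also have "\<dots> \<le> ennreal K ^ DIM('a) * ((\<integral>\<^sup>+x. ennreal (f x powr (1 / a)) \<partial>lborel) powr\<^sub>e a *
      (\<integral>\<^sup>+x. ennreal (g x powr (1 / b)) \<partial>lborel) powr\<^sub>e b * (\<integral>\<^sup>+x. ennreal (h x powr p) \<partial>lborel) powr\<^sub>e c)"
    unfolding K_def by (rule brascamp_lieb_euclidean) (use ab c01 sum in auto)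
  also have "\<dots> \<le> ennreal K ^ DIM('a) * (ennreal (F powr (l / p)) * ennreal (G powr ((1 - l) / p)) * ennreal (H powr c))"
  proof (intro mult_left_mono mult_mono)
    show "(\<integral>\<^sup>+x. ennreal (f x powr (1 / a)) \<partial>lborel) powr\<^sub>e a \<le> ennreal (F powr (l / p))"
      unfolding ea[symmetric] using ab q nn one F
      by (intro powr_mono_e nn_integral_powr_interpolation) auto
    show "(\<integral>\<^sup>+x. ennreal (g x powr (1 / b)) \<partial>lborel) powr\<^sub>e b \<le> ennreal (G powr ((1 - l) / p))"
      unfolding ea[symmetric] using ab q nn one G
      by (intro powr_mono_e nn_integral_powr_interpolation) auto
    show "(\<integral>\<^sup>+x. ennreal (h x powr p) \<partial>lborel) powr\<^sub>e c \<le> ennreal (H powr c)"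
      using H by simp
  qed auto
  also have "\<dots> = ennreal (K ^ DIM('a) * (F powr (l / p) * G powr ((1 - l) / p) * H powr c))"
    using K0 by (simp add: ennreal_mult ennreal_power)
  finally have "H \<le> K ^ DIM('a) * (F powr (l / p) * G powr ((1 - l) / p) * H powr c)"
    using K0 by (simp add: ennreal_le_iff)
  then have "ln H \<le> ln (K ^ DIM('a) * (F powr (l / p) * G powr ((1 - l) / p) * H powr c))"
    using H by simp
  also have "\<dots> = DIM('a) * ln K + l / p * ln F + (1 - l) / p * ln G + c * ln H"
    using K0 F G H by (simp add: ln_mult ln_realpow ln_powr)
  \<comment> \<open>The integral of \<open>h powr p\<close> occurs on both sides; as
    \<open>H\<close> is finite and positive, its logarithm can be collected on the left, and
    \<open>p * (1 - c) = 1\<close>.\<close>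
  finally have "(1 - c) * ln H \<le> DIM('a) * ln K + l / p * ln F + (1 - l) / p * ln G" by (simp add: algebra_simps)
  then have "p * ((1 - c) * ln H) \<le> p * (DIM('a) * ln K + l / p * ln F + (1 - l) / p * ln G)"
    using p by (intro mult_left_mono) auto
  moreover have "p * ((1 - c) * ln H) = ln H" using p by (simp add: c field_simps)
  moreover have "p * (DIM('a) * ln K + l / p * ln F + (1 - l) / p * ln G) = p * DIM('a) * ln K + l * ln F + (1 - l) * ln G"
    using p by (simp add: field_simps)
  ultimately show ?thesis by (simp add: K_def a_def b_def)
qed

section \<open>Optimising the weight\<close>

text \<open>The terms in \<open>ln c\<close> cancel, and the coefficients of
  \<open>ln (1 - l * c)\<close> and \<open>ln (1 - (1 - l) * c)\<close> combine to the arguments of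
  these logarithms, as in \<open>entropy_gap\<close>.\<close>

lemma ln_young_const:
  assumes l: "0 < l" "l < 1" and c: "0 < c" "c < 1"
  shows "- 2 * ln (young_const (1 - l * c) (1 - (1 - l) * c) c) = c * entropy_gap 1 l - entropy_gap c l"
proof -
  have "l * c < 1 * 1" "(1 - l) * c < 1 * 1" using l c by (intro mult_strict_mono; simp)+
  then have ab: "0 < 1 - l * c" "0 < 1 - (1 - l) * c" by auto
  have "- 2 * ln (young_const (1 - l * c) (1 - (1 - l) * c) c) =
    - (l * c * (ln (l * c) - (ln (1 - (1 - l) * c) + ln c)) + (1 - l) * c * (ln ((1 - l) * c) - (ln (1 - l * c) + ln c))
      + (1 - c) * (ln (1 - c) - (ln (1 - l * c) + ln (1 - (1 - l) * c))))"
    unfolding young_const_def ln_exp using l c ab by (simp add: ln_div ln_mult_pos)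
  also have "\<dots> = c * entropy_gap 1 l - entropy_gap c l"
    unfolding entropy_gap_1 unfolding entropy_gap_def using l c by (simp add: ln_mult_pos) (simp add: algebra_simps)
  finally show ?thesis .
qed

text \<open>Makes the exponent positive. Comparing coefficients via
  \<open>c ^ (k + 2) \<le> c\<^sup>2\<close> bounds the gap by \<open>c\<^sup>2\<close> times its
  value \<open>ln 2\<close> at \<open>c = 1\<close>.\<close>

lemma entropy_gap_half_less:
  assumes "0 < c" "c < 1"
  shows "entropy_gap c (1 / 2) < c * ln 2"
proof -
  have "(\<lambda>k. power_defect (k + 2) (1 / 2) / ((k + 1) * (k + 2)) * c ^ (k + 2)) sums entropy_gap c (1 / 2)"
    using assms by (intro entropy_gap_sums) auto
  moreover have "(\<lambda>k. power_defect (k + 2) (1 / 2) / ((k + 1) * (k + 2)) * c\<^sup>2) sums (ln 2 * c\<^sup>2)"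
    using sums_mult2[OF entropy_gap_sums[of 1 "1 / 2"], of "c\<^sup>2"] by (simp add: entropy_gap_1 ln_div)
  ultimately have "entropy_gap c (1 / 2) \<le> ln 2 * c\<^sup>2"
  proof (rule sums_le[rotated])
    show "power_defect (k + 2) (1 / 2) / ((k + 1) * (k + 2)) * c ^ (k + 2) \<le> power_defect (k + 2) (1 / 2) / ((k + 1) * (k + 2)) * c\<^sup>2" for k
      using assms power_defect_half_pos[of k] by (intro mult_left_mono power_decreasing divide_nonneg_nonneg) auto
  qed
  also have "\<dots> < c * ln 2" using assms by (simp add: power2_eq_square)
  finally show ?thesis .
qed

text \<open>Here \<open>1 - c = 1 / p\<close> and \<open>1 - c / 2 = (p + 1) / (2 * p)\<close>,
  which are the logarithms' arguments in the exponent, up to inversion of \<open>p\<close>.\<close>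

lemma renyi_epi_exponent_eq:
  assumes "p > 1" and c: "c = (p - 1) / p"
  shows "renyi_epi_exponent p = inverse (1 - entropy_gap c (1 / 2) / (c * ln 2))"
proof -
  have e: "1 - c = 1 / p" "1 - 1 / 2 * c = (p + 1) / (2 * p)" "(1 - 1 / 2) * c = 1 / 2 * c"
    using assms(1) by (auto simp: c field_simps)
  define L where "L = ln ((p + 1) / (2 * p))"
  have gap: "entropy_gap c (1 / 2) = - ((ln p + (p + 1) * L) / p)"
    unfolding entropy_gap_def e L_def[symmetric] using assms(1) by (simp add: ln_div field_simps)
  have "- entropy_gap c (1 / 2) / c = (ln p + (p + 1) * L) / (p - 1)"
    unfolding gap using assms(1) by (simp add: c)
  also have "\<dots> = (p + 1) / (p - 1) * L + ln p / (p - 1)"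
    by (subst add_divide_distrib) simp
  finally have "1 + 1 / ln 2 * ((p + 1) / (p - 1) * L + ln p / (p - 1)) = 1 + 1 / ln 2 * (- entropy_gap c (1 / 2) / c)"
    by simp
  also have "\<dots> = 1 - entropy_gap c (1 / 2) / (c * ln 2)" by (simp add: mult.commute)
  finally show ?thesis by (simp only: renyi_epi_exponent_def L_def)
qed

text \<open>Choosing \<open>l\<close> proportional to \<open>exp (\<alpha> * x)\<close> turns the convex combination plus the scaled binary
  entropy into the logarithm of the sum.\<close>

lemma exp_powr_sum_le:
  fixes w x y :: real
  assumes c: "0 < c" "c < 1"
    and w: "\<And>l. 0 < l \<Longrightarrow> l < 1 \<Longrightarrow> l * x + (1 - l) * y + entropy_gap 1 l - entropy_gap c l / c \<le> w"
  defines "\<alpha> \<equiv> inverse (1 - entropy_gap c (1 / 2) / (c * ln 2))"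
  shows "exp x powr \<alpha> + exp y powr \<alpha> \<le> exp w powr \<alpha>"
proof -
  define k where "k = 1 - entropy_gap c (1 / 2) / (c * ln 2)"
  have "entropy_gap c (1 / 2) / (c * ln 2) < 1"
    using entropy_gap_half_less[OF c] c by (simp add: divide_less_eq)
  then have k0: "k > 0" by (simp add: k_def)
  then have a0: "\<alpha> > 0" and ak: "\<alpha> * k = 1"
    unfolding \<alpha>_def k_def[symmetric] by simp_all
  define S where "S = exp (\<alpha> * x) + exp (\<alpha> * y)"
  define l where "l = exp (\<alpha> * x) / S"
  have S0: "S > 0" by (simp add: S_def add_pos_pos)
  have l1: "1 - l = exp (\<alpha> * y) / S" using S0 by (simp add: l_def S_def field_simps)
  have l: "0 < l" "l < 1" using S0 l1 by (auto simp: l_def S_def field_simps)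
  \<comment> \<open>The equality case of the Gibbs variational formula for
    \<open>ln S\<close>.\<close>
  have H: "entropy_gap 1 l = ln S - (l * (\<alpha> * x) + (1 - l) * (\<alpha> * y))"
  proof -
    have ln_l: "ln l = \<alpha> * x - ln S" using S0 by (simp add: l_def ln_div)
    have ln_1l: "ln (1 - l) = \<alpha> * y - ln S" using S0 by (simp add: l1 ln_div)
    show ?thesis unfolding entropy_gap_1 ln_l ln_1l by (simp add: algebra_simps)
  qed
  \<comment> \<open>This leaves the binary entropy with coefficient \<open>k = 1 / \<alpha>\<close>,
    exactly what the variational formula needs after multiplication by
    \<open>\<alpha>\<close>.\<close>
  have "entropy_gap c l \<le> entropy_gap c (1 / 2) * entropy_gap 1 l / ln 2"
    using entropy_gap_ratio_le[of c l] c l by (simp add: pos_le_divide_eq)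
  then have "entropy_gap c l / c \<le> entropy_gap c (1 / 2) * entropy_gap 1 l / ln 2 / c"
    using c by (intro divide_right_mono) auto
  also have "\<dots> = entropy_gap 1 l - k * entropy_gap 1 l"
    using c by (simp add: k_def field_simps)
  finally have "l * x + (1 - l) * y + k * entropy_gap 1 l \<le> w" using w[OF l] by linarith
  then have "\<alpha> * (l * x + (1 - l) * y + k * entropy_gap 1 l) \<le> \<alpha> * w"
    using a0 by (intro mult_left_mono) auto
  also have "\<alpha> * (l * x + (1 - l) * y + k * entropy_gap 1 l) = \<alpha> * (l * x + (1 - l) * y) + (\<alpha> * k) * entropy_gap 1 l"
    by (simp add: algebra_simps)
  also have "\<dots> = ln S" unfolding ak H by (simp add: algebra_simps)
  finally have "exp (ln S) \<le> exp (\<alpha> * w)" by simp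
  then have "S \<le> exp (\<alpha> * w)" using S0 by simp
  then show ?thesis by (simp add: S_def powr_def)
qed

section \<open>Entropies of sums\<close>

lemma (in prob_space) nn_integral_sum_indep:
  fixes X Y :: "'a \<Rightarrow> 'b::euclidean_space"
  assumes ind: "indep_var borel X borel Y"
    and X: "distributed M lborel X f" and Y: "distributed M lborel Y g"
    and [measurable]: "u \<in> borel_measurable borel"
  shows "(\<integral>\<^sup>+\<omega>. u (X \<omega> + Y \<omega>) \<partial>M) = (\<integral>\<^sup>+x. \<integral>\<^sup>+y. f x * g y * u (x + y) \<partial>lborel \<partial>lborel)"
proof -
  have [measurable]: "X \<in> borel_measurable M" "Y \<in> borel_measurable M" "f \<in> borel_measurable borel" "g \<in> borel_measurable borel"
    using X Y by (auto simp: distributed_def)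
  have dX: "distr M borel X = density lborel f" and dY: "distr M borel Y = density lborel g"
    using distributed_distr_eq_density[OF X] distributed_distr_eq_density[OF Y]
    by (metis distr_cong sets_lborel)+
  interpret DY: prob_space "density lborel g" unfolding dY[symmetric] by (rule prob_space_distr) simp
  have "(\<integral>\<^sup>+\<omega>. u (X \<omega> + Y \<omega>) \<partial>M) = (\<integral>\<^sup>+z. u (fst z + snd z) \<partial>distr M (borel \<Otimes>\<^sub>M borel) (\<lambda>\<omega>. (X \<omega>, Y \<omega>)))"
    by (simp add: nn_integral_distr)
  also have "distr M (borel \<Otimes>\<^sub>M borel) (\<lambda>\<omega>. (X \<omega>, Y \<omega>)) = density lborel f \<Otimes>\<^sub>M density lborel g"
    using ind by (simp add: indep_var_distribution_eq dX dY)
  also have "(\<integral>\<^sup>+z. u (fst z + snd z) \<partial>(density lborel f \<Otimes>\<^sub>M density lborel g)) =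
      (\<integral>\<^sup>+x. \<integral>\<^sup>+y. u (x + y) \<partial>density lborel g \<partial>density lborel f)"
    by (subst DY.nn_integral_fst[symmetric]) simp_all
  also have "\<dots> = (\<integral>\<^sup>+x. f x * (\<integral>\<^sup>+y. g y * u (x + y) \<partial>lborel) \<partial>lborel)"
    by (simp add: nn_integral_density)
  also have "\<dots> = (\<integral>\<^sup>+x. \<integral>\<^sup>+y. f x * g y * u (x + y) \<partial>lborel \<partial>lborel)"
    by (simp add: nn_integral_cmult[symmetric] mult.assoc)
  finally show ?thesis .
qed

lemma nn_integral_lborel_translate:
  fixes u :: "'a::euclidean_space \<Rightarrow> ennreal"
  assumes [measurable]: "u \<in> borel_measurable borel"
  shows "(\<integral>\<^sup>+x. u (c + x) \<partial>lborel) = (\<integral>\<^sup>+x. u x \<partial>lborel)"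
  by (subst (2) lborel_distr_plus[of c, symmetric]) (simp add: nn_integral_distr)

text \<open>The convolution formula: compare both measures on a set \<open>A\<close>, substitute
  \<open>z = x + y\<close> in the inner integral and exchange the integrals.\<close>

lemma (in prob_space) distributed_sum_indep:
  fixes X Y :: "'a \<Rightarrow> 'b::euclidean_space"
  assumes ind: "indep_var borel X borel Y"
    and X: "distributed M lborel X f" and Y: "distributed M lborel Y g"
  shows "distributed M lborel (\<lambda>\<omega>. X \<omega> + Y \<omega>) (\<lambda>z. \<integral>\<^sup>+x. f x * g (z - x) \<partial>lborel)"
proof -
  have [measurable]: "X \<in> borel_measurable M" "Y \<in> borel_measurable M" "f \<in> borel_measurable borel" "g \<in> borel_measurable borel"
    using X Y by (auto simp: distributed_def)
  show ?thesis unfolding distributed_def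
  proof (intro conjI measure_eqI)
    fix A assume "A \<in> sets (distr M lborel (\<lambda>\<omega>. X \<omega> + Y \<omega>))"
    then have [measurable]: "A \<in> sets borel" by simp
    have "emeasure (distr M lborel (\<lambda>\<omega>. X \<omega> + Y \<omega>)) A = (\<integral>\<^sup>+z. indicator A z \<partial>distr M lborel (\<lambda>\<omega>. X \<omega> + Y \<omega>))"
      by simp
    also have "\<dots> = (\<integral>\<^sup>+\<omega>. indicator A (X \<omega> + Y \<omega>) \<partial>M)"
      by (subst nn_integral_distr) auto
    also have "\<dots> = (\<integral>\<^sup>+x. \<integral>\<^sup>+y. f x * g y * indicator A (x + y) \<partial>lborel \<partial>lborel)"
      by (rule nn_integral_sum_indep[OF ind X Y]) simp
    also have "\<dots> = (\<integral>\<^sup>+x. \<integral>\<^sup>+z. f x * g (z - x) * indicator A z \<partial>lborel \<partial>lborel)"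
    proof (rule nn_integral_cong)
      fix x show "(\<integral>\<^sup>+y. f x * g y * indicator A (x + y) \<partial>lborel) = (\<integral>\<^sup>+z. f x * g (z - x) * indicator A z \<partial>lborel)"
        using nn_integral_lborel_translate[of "\<lambda>z. f x * g (z - x) * indicator A z" x] by simp
    qed
    also have "\<dots> = (\<integral>\<^sup>+z. \<integral>\<^sup>+x. f x * g (z - x) * indicator A z \<partial>lborel \<partial>lborel)"
      by (rule lborel_pair.Fubini') measurable
    also have "\<dots> = emeasure (density lborel (\<lambda>z. \<integral>\<^sup>+x. f x * g (z - x) \<partial>lborel)) A"
      by (simp add: emeasure_density nn_integral_multc)
    finally show "emeasure (distr M lborel (\<lambda>\<omega>. X \<omega> + Y \<omega>)) A =
      emeasure (density lborel (\<lambda>z. \<integral>\<^sup>+x. f x * g (z - x) \<partial>lborel)) A" .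
  qed simp_all
qed

text \<open>Finite entropy excludes the values 0 and \<open>\<top>\<close> of the integral, at which
  \<open>ln_ennreal\<close> is infinite, and \<open>1 / (1 - p)\<close> is nonzero.\<close>

lemma finite_renyi_entropyE:
  fixes X :: "'w \<Rightarrow> real ^ 'n"
  assumes X: "distributed M lborel X f" and "p > 1" and fin: "\<bar>renyi_entropy p M X\<bar> \<noteq> \<infinity>"
  obtains J where "J > 0" "(\<integral>\<^sup>+x. ennreal (enn2real (f x) powr p) \<partial>lborel) = ennreal J"
    "renyi_entropy_power p M X = exp (2 * (1 / (1 - p) * ln J) / real CARD('n))"
proof -
  define I where "I = (\<integral>\<^sup>+x. ennreal (enn2real (f x) powr p) \<partial>lborel)"
  have eq: "renyi_entropy p M X = ereal (1 / (1 - p)) * ln_ennreal I"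
    unfolding I_def by (rule renyi_entropy_eq[OF X])
  have "I \<noteq> 0" "I \<noteq> \<top>"
    using fin \<open>p > 1\<close> unfolding eq by (auto simp: ln_ennreal_def)
  then obtain J where J: "I = ennreal J" "J > 0"
    by (cases I) (auto simp: ennreal_eq_0_iff)
  then have "ln_ennreal I = ereal (ln J)" by (simp add: ln_ennreal_def)
  then have "renyi_entropy_power p M X = exp (2 * (1 / (1 - p) * ln J) / real CARD('n))"
    by (simp add: renyi_entropy_power_def eq)
  with J show thesis using that unfolding I_def by blast
qed

lemma (in prob_space) distributed_enn2real:
  assumes X: "distributed M lborel X f"
  shows "AE x in lborel. f x = ennreal (enn2real (f x))" "(\<integral>\<^sup>+x. ennreal (enn2real (f x)) \<partial>lborel) = 1"
proof -
  have [measurable]: "f \<in> borel_measurable lborel" "X \<in> measurable M lborel"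
    using X by (auto simp: distributed_def)
  have one: "(\<integral>\<^sup>+x. f x \<partial>lborel) = 1"
    using distributed_nn_integral[OF X, of "\<lambda>_. 1"] by (simp add: emeasure_space_1)
  then have "AE x in lborel. f x \<noteq> \<infinity>" by (intro nn_integral_PInf_AE) auto
  then show ae: "AE x in lborel. f x = ennreal (enn2real (f x))"
    by eventually_elim (simp add: less_top)
  show "(\<integral>\<^sup>+x. ennreal (enn2real (f x)) \<partial>lborel) = 1"
    using nn_integral_cong_AE[OF ae] one by simp
qed

theorem theorem2p1:
  fixes M :: "'w measure"
    and X Y :: "'w \<Rightarrow> real ^ 'n"
    and f g :: "real ^ 'n \<Rightarrow> ennreal"
    and p :: real
  assumes "prob_space M"
    and "p > 1"
    and "prob_space.indep_var M borel X borel Y"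
    and "distributed M lborel X f"
    and "distributed M lborel Y g"
    and "\<bar>renyi_entropy p M X\<bar> \<noteq> \<infinity>"
    and "\<bar>renyi_entropy p M Y\<bar> \<noteq> \<infinity>"
    and "\<bar>renyi_entropy p M (\<lambda>\<omega>. X \<omega> + Y \<omega>)\<bar> \<noteq> \<infinity>"
  shows "renyi_entropy_power p M (\<lambda>\<omega>. X \<omega> + Y \<omega>) powr renyi_epi_exponent p \<ge>
    renyi_entropy_power p M X powr renyi_epi_exponent p +
    renyi_entropy_power p M Y powr renyi_epi_exponent p"
proof -
  interpret prob_space M by fact
  note p = \<open>p > 1\<close>
  define h where "h z = (\<integral>\<^sup>+x. f x * g (z - x) \<partial>lborel)" for z
  have Z: "distributed M lborel (\<lambda>\<omega>. X \<omega> + Y \<omega>) h"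
    unfolding h_def by (rule distributed_sum_indep) fact+
  obtain F where F: "F > 0" "(\<integral>\<^sup>+x. ennreal (enn2real (f x) powr p) \<partial>lborel) = ennreal F"
    "renyi_entropy_power p M X = exp (2 * (1 / (1 - p) * ln F) / real CARD('n))"
    by (rule finite_renyi_entropyE[OF assms(4,2,6)])
  obtain G where G: "G > 0" "(\<integral>\<^sup>+x. ennreal (enn2real (g x) powr p) \<partial>lborel) = ennreal G"
    "renyi_entropy_power p M Y = exp (2 * (1 / (1 - p) * ln G) / real CARD('n))"
    by (rule finite_renyi_entropyE[OF assms(5,2,7)])
  obtain H where H: "H > 0" "(\<integral>\<^sup>+x. ennreal (enn2real (h x) powr p) \<partial>lborel) = ennreal H"
    "renyi_entropy_power p M (\<lambda>\<omega>. X \<omega> + Y \<omega>) = exp (2 * (1 / (1 - p) * ln H) / real CARD('n))"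
    by (rule finite_renyi_entropyE[OF Z assms(2,8)])
  have [measurable]: "f \<in> borel_measurable borel" "g \<in> borel_measurable borel" "h \<in> borel_measurable borel"
    using assms(4,5) Z by (auto simp: distributed_def)
  note f = distributed_enn2real[OF assms(4)] and g = distributed_enn2real[OF assms(5)] and h = distributed_enn2real[OF Z]
  define v where "v z = ennreal (enn2real (h z) powr (p - 1))" for z
  have [measurable]: "v \<in> borel_measurable borel" unfolding v_def by measurable
  \<comment> \<open>Splitting off one factor \<open>h\<close> reads the integral as the expectation
    of \<open>h (X + Y) powr (p - 1)\<close>, which independence turns into a double integral
    against \<open>f\<close> and \<open>g\<close>.\<close>
  have "(\<integral>\<^sup>+z. ennreal (enn2real (h z) powr p) \<partial>lborel) = (\<integral>\<^sup>+z. h z * v z \<partial>lborel)"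
  proof (rule nn_integral_cong_AE, use h(1) in eventually_elim)
    case (elim z)
    have "ennreal (enn2real (h z) powr p) = ennreal (enn2real (h z)) * v z"
    proof -
      have "enn2real (h z) powr p = enn2real (h z) powr (1 + (p - 1))" by simp
      also have "\<dots> = enn2real (h z) * enn2real (h z) powr (p - 1)"
        unfolding powr_add by simp
      finally show ?thesis by (simp add: v_def ennreal_mult)
    qed
    then show ?case using elim by simp
  qed
  also have "\<dots> = (\<integral>\<^sup>+\<omega>. v (X \<omega> + Y \<omega>) \<partial>M)"
    using Z by (rule distributed_nn_integral) simp
  also have "\<dots> = (\<integral>\<^sup>+x. \<integral>\<^sup>+y. f x * g y * v (x + y) \<partial>lborel \<partial>lborel)"
    by (rule nn_integral_sum_indep[OF assms(3,4,5)]) simp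
  also have "\<dots> = (\<integral>\<^sup>+x. \<integral>\<^sup>+y. ennreal (enn2real (f x) * enn2real (g y) * enn2real (h (x + y)) powr (p - 1)) \<partial>lborel \<partial>lborel)"
  proof (rule nn_integral_cong_AE, use f(1) in eventually_elim)
    case fx: (elim x)
    show ?case
    proof (rule nn_integral_cong_AE, use g(1) in eventually_elim)
      case (elim y)
      show ?case by (subst fx, subst elim) (simp add: v_def ennreal_mult)
    qed
  qed
  finally have conv: "(\<integral>\<^sup>+z. ennreal (enn2real (h z) powr p) \<partial>lborel) = \<dots>" .
  define c where "c = (p - 1) / p"
  have c: "0 < c" "c < 1" using p by (auto simp: c_def)
  define n where "n = real CARD('n)"
  have n: "n > 0" by (simp add: n_def)
  \<comment> \<open>With this scaling each entropy power is \<open>exp (- r * ln J)\<close>, where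
    \<open>J\<close> is the integral of the \<open>p\<close>-th power of the density.\<close>
  define r where "r = 2 / (n * (p - 1))"
  have r: "r > 0" using n p by (simp add: r_def)
  have N: "2 * (1 / (1 - p) * t) / n = - r * t" for t
    using p n by (simp add: r_def field_simps)
  show ?thesis unfolding F(3) G(3) H(3) renyi_epi_exponent_eq[OF p c_def] n_def[symmetric] N
  proof (rule exp_powr_sum_le[OF c])
    fix l :: real assume l: "0 < l" "l < 1"
    define K where "K = young_const (1 - l * c) (1 - (1 - l) * c) c"
    have "ln H \<le> p * DIM(real ^ 'n) * ln K + l * ln F + (1 - l) * ln G"
      unfolding K_def by (rule ln_powr_integral_convolution_le[OF p l c_def _ _ _ _ _ _ f(2) g(2) F(2,1) G(2,1) H(2,1) conv]) auto
    then have "r * ln H \<le> r * (p * n * ln K + l * ln F + (1 - l) * ln G)"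
      using r by (intro mult_left_mono) (auto simp: n_def)
    \<comment> \<open>The dimension cancels here, so the remaining inequality involves only
      \<open>c\<close> and \<open>l\<close>.\<close>
    moreover have "r * (p * n * ln K) = 2 * ln K / c"
      using n p by (simp add: r_def c_def field_simps)
    moreover have "2 * ln K / c = - (entropy_gap 1 l - entropy_gap c l / c)"
      using ln_young_const[OF l c] c unfolding K_def by (simp add: field_simps)
    ultimately show "l * (- r * ln F) + (1 - l) * (- r * ln G) + entropy_gap 1 l - entropy_gap c l / c \<le> - r * ln H"
      by (simp add: algebra_simps)
  qed
qed

end
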